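(* Let $K$ be a field of characteristic $p\ge 0$ (so $p=0$ or $p$ is a prime). Let $G=\bigcup_i G_i$ be the group of the construction in the context, where the sequence of primes $p_1,p_2,\dots$ satisfies $p_{i+1}\ne p_i$ for all $i$ and, for every index $i$, there exist indices $u,v$ with $i<u<v$ and $p_u=p_v\ne p$. Then every nonzero two-sided ideal of the group algebra $K[G]$ has finite codimension in $K[G]$.
   Context: For a group $X$ acted on by $Y$, $[X,Y]$ is generated by all $x^{-1}x^{y}$. A finite $p$-group $P$ is extra-special if $P'=Z(P)$ has order $p$. Construction: given an infinite sequence of primes $p_1,p_2,\dots$ with $p_{i+1}\ne p_i$ for all $i$, define finite groups $G_1\le G_2\le\cdots$ and subgroups $R_i\le G_i$ recursively. Let $G_1=R_1$ be cyclic of order $p_1$. For $i\ge2$: let $M_i$ be an extra-special group of order $p_i^3$; let $B$ be the base group of the regular wreath product $M_i\wr G_{i-1}$ (direct product of $|G_{i-1}|$ copies of $M_i$, permuted regularly by $G_{i-1}$); let $B_i=B/[B',G_{i-1}]$ with the induced $G_{i-1}$-action; $D_i=[B_i,R_{i-1}]$; $G_i=D_i\rtimes G_{i-1}$; $R_i=D_i'$. $G$ is the union (direct limit) of $G_1\le G_2\le\cdots$. *)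

theory Defs
  imports "HOL-Algebra.Product_Groups" "HOL-Algebra.Generated_Groups" "HOL-Algebra.Coset"
    "HOL-Computational_Algebra.Primes"
begin

definition grp_center :: "('a, 'b) monoid_scheme \<Rightarrow> 'a set" where
  "grp_center P = {z \<in> carrier P. \<forall>x \<in> carrier P. z \<otimes>\<^bsub>P\<^esub> x = x \<otimes>\<^bsub>P\<^esub> z}"

definition extra_special :: "('a, 'b) monoid_scheme \<Rightarrow> nat \<Rightarrow> bool" where
  "extra_special P p \<longleftrightarrow> group P \<and> prime p \<and> finite (carrier P)
     \<and> (\<exists>n. card (carrier P) = p ^ n)
     \<and> derived P (carrier P) = grp_center P \<and> card (grp_center P) = p"

text \<open>Regular (right) action of the subgroup with carrier H of G on functions H -> M
  (the base group of the regular wreath product): (f^g)(x) = f(x g^-1).\<close>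
definition reg_act :: "('g, 'b) monoid_scheme \<Rightarrow> 'g set \<Rightarrow> ('g \<Rightarrow> 'm) \<Rightarrow> 'g \<Rightarrow> ('g \<Rightarrow> 'm)" where
  "reg_act G H f g = (\<lambda>x\<in>H. f (x \<otimes>\<^bsub>G\<^esub> inv\<^bsub>G\<^esub> g))"

definition base_group :: "'g set \<Rightarrow> ('m, 'c) monoid_scheme \<Rightarrow> ('g \<Rightarrow> 'm) monoid" where
  "base_group H M = product_group H (\<lambda>_. M)"

definition act_comm :: "('x, 'c) monoid_scheme \<Rightarrow> 'x set \<Rightarrow> 'a set \<Rightarrow> ('x \<Rightarrow> 'a \<Rightarrow> 'x) \<Rightarrow> 'x set" where
  "act_comm X S A act = generate X {inv\<^bsub>X\<^esub> x \<otimes>\<^bsub>X\<^esub> act x a | x a. x \<in> S \<and> a \<in> A}"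

definition wr_N :: "('g, 'b) monoid_scheme \<Rightarrow> 'g set \<Rightarrow> ('m, 'c) monoid_scheme \<Rightarrow> ('g \<Rightarrow> 'm) set" where
  "wr_N G H M = act_comm (base_group H M) (derived (base_group H M) (carrier (base_group H M)))
                  H (reg_act G H)"

definition wr_Bq :: "('g, 'b) monoid_scheme \<Rightarrow> 'g set \<Rightarrow> ('m, 'c) monoid_scheme \<Rightarrow> ('g \<Rightarrow> 'm) set monoid" where
  "wr_Bq G H M = base_group H M Mod wr_N G H M"

definition coset_act :: "('g, 'b) monoid_scheme \<Rightarrow> 'g set \<Rightarrow> ('g \<Rightarrow> 'm) set \<Rightarrow> 'g \<Rightarrow> ('g \<Rightarrow> 'm) set" where
  "coset_act G H C g = (\<lambda>f. reg_act G H f g) ` C"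

definition wr_D :: "('g, 'b) monoid_scheme \<Rightarrow> 'g set \<Rightarrow> 'g set \<Rightarrow> ('m, 'c) monoid_scheme \<Rightarrow> ('g \<Rightarrow> 'm) set set" where
  "wr_D G H R M = act_comm (wr_Bq G H M) (carrier (wr_Bq G H M)) R (coset_act G H)"

text \<open>One step of the construction, realised internally in the ambient group G:
  Gi = Di \<rtimes> Gprev, where Di is a normal subgroup of Gi with Di \<inter> Gprev = 1 and
  Di Gprev = Gi, and Di is isomorphic, compatibly with the action of Gprev
  (conjugation x^g = g^-1 x g on Di, the induced regular action on B_i), to
  [B_i, Rprev]; furthermore Ri = Di'.\<close>
definition constr_step :: "('g, 'b) monoid_scheme \<Rightarrow> 'g set \<Rightarrow> 'g set \<Rightarrow> ('m, 'c) monoid_scheme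
     \<Rightarrow> 'g set \<Rightarrow> 'g set \<Rightarrow> 'g set \<Rightarrow> bool" where
  "constr_step G Gprev Rprev M Gi Di Ri \<longleftrightarrow>
     subgroup Gi G \<and> subgroup Di G \<and>
     (\<forall>g \<in> Gi. \<forall>d \<in> Di. inv\<^bsub>G\<^esub> g \<otimes>\<^bsub>G\<^esub> d \<otimes>\<^bsub>G\<^esub> g \<in> Di) \<and>
     Di \<inter> Gprev = {\<one>\<^bsub>G\<^esub>} \<and> Di <#>\<^bsub>G\<^esub> Gprev = Gi \<and>
     Ri = derived G Di \<and>
     (\<exists>\<phi>. bij_betw \<phi> Di (wr_D G Gprev Rprev M) \<and>
        (\<forall>x \<in> Di. \<forall>y \<in> Di. \<phi> (x \<otimes>\<^bsub>G\<^esub> y) = \<phi> x \<otimes>\<^bsub>wr_Bq G Gprev M\<^esub> \<phi> y) \<and>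
        (\<forall>d \<in> Di. \<forall>g \<in> Gprev.
            \<phi> (inv\<^bsub>G\<^esub> g \<otimes>\<^bsub>G\<^esub> d \<otimes>\<^bsub>G\<^esub> g) = coset_act G Gprev (\<phi> d) g))"

definition group_algebra :: "('g, 'b) monoid_scheme \<Rightarrow> ('g \<Rightarrow> 'k::field) set" where
  "group_algebra G = {f. finite {x. f x \<noteq> 0} \<and> {x. f x \<noteq> 0} \<subseteq> carrier G}"

definition ga_mult :: "('g, 'b) monoid_scheme \<Rightarrow> ('g \<Rightarrow> 'k::field) \<Rightarrow> ('g \<Rightarrow> 'k) \<Rightarrow> ('g \<Rightarrow> 'k)" where
  "ga_mult G f h = (\<lambda>x. if x \<in> carrier G
       then (\<Sum>y \<in> {y. f y \<noteq> 0}. f y * h (inv\<^bsub>G\<^esub> y \<otimes>\<^bsub>G\<^esub> x)) else 0)"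

definition two_sided_ideal :: "('g, 'b) monoid_scheme \<Rightarrow> ('g \<Rightarrow> 'k::field) set \<Rightarrow> bool" where
  "two_sided_ideal G I \<longleftrightarrow> I \<subseteq> group_algebra G \<and> (\<lambda>_. 0) \<in> I \<and>
     (\<forall>f \<in> I. \<forall>h \<in> I. (\<lambda>x. f x + h x) \<in> I) \<and>
     (\<forall>c. \<forall>f \<in> I. (\<lambda>x. c * f x) \<in> I) \<and>
     (\<forall>a \<in> group_algebra G. \<forall>f \<in> I. ga_mult G a f \<in> I \<and> ga_mult G f a \<in> I)"

definition finite_codim :: "('g, 'b) monoid_scheme \<Rightarrow> ('g \<Rightarrow> 'k::field) set \<Rightarrow> bool" where
  "finite_codim G I \<longleftrightarrow> (\<exists>S. finite S \<and> S \<subseteq> group_algebra G \<and>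
     (\<forall>f \<in> group_algebra G. \<exists>c. \<exists>h \<in> I. f = (\<lambda>x. (\<Sum>s \<in> S. c s * s x) + h x)))"

end

theory Submission
  imports Defs "HOL-Algebra.Multiplicative_Group" "HOL-Number_Theory.Cong"
begin

text \<open>
  Let \<open>K\<close> be the set of all \<open>x\<close> with \<open>1 - x\<close> in the ideal \<open>I\<close>, a normal subgroup of \<open>G\<close>. If \<open>R\<^sub>i\<close>
  lies in \<open>K\<close>, then so does \<open>D\<^bsub>i+1\<^esub>\<close>: modulo \<open>K\<close> it is generated by elements whose order divides both
  \<open>p\<^sub>i\<close> and a power of \<open>p\<^bsub>i+1\<^esub>\<close>. Hence \<open>G = K G\<^sub>u\<close> as soon as one \<open>R\<^sub>u\<close> lies in \<open>K\<close>, and the codimension of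
  \<open>I\<close> is at most \<open>card G\<^sub>u\<close>.

  To find such a \<open>u\<close>, take \<open>f\<close> in \<open>I\<close> with \<open>f(1) \<noteq> 0\<close> and support in \<open>H = G\<^bsub>u-1\<^esub>\<close>, where \<open>p\<^sub>u\<close> is not the
  characteristic. The group \<open>D = D\<^sub>u\<close> has a subgroup \<open>T\<close> avoiding the centre \<open>R\<^sub>u\<close> such that for
  \<open>1 \<noteq> h \<in> H\<close> the product of \<open>T\<close> and \<open>h T h\<inverse>\<close> meets \<open>R\<^sub>u\<close> nontrivially. For \<open>z\<close> in \<open>R\<^sub>u\<close> the element
  \<open>1 - z\<close> therefore annihilates \<open>\<Sum> t h t'\<close> (\<open>t\<close>, \<open>t'\<close> ranging over \<open>T\<close>), and it also annihilates
  \<open>\<Sum> d t d\<inverse>\<close> (\<open>d\<close> ranging over \<open>D\<close>) for \<open>1 \<noteq> t \<in> T\<close>, because \<open>t\<close> is not central in \<open>D\<close>. So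
  \<open>\<Sum> d t f t' d\<inverse> (1 - z) = f(1) card T card D (1 - z)\<close> lies in \<open>I\<close>, and \<open>z\<close> lies in \<open>K\<close>.
\<close>

section \<open>Extra-special groups\<close>

text \<open>The pair is fixed once and for all: powers of \<open>a\<close> serve as coordinates, and
  powers of \<open>b\<close> test them through commutators, whose values are powers of a central
  element.\<close>

locale ncomm_pair = group M for M :: "('m, 'c) monoid_scheme" (structure) +
  fixes q m :: nat and a b
  assumes prime_q: "prime q"
    and card_M: "card (carrier M) = q ^ m"
    and derived_M: "derived M (carrier M) = grp_center M"
    and card_center: "card (grp_center M) = q"
    and a_closed [simp, intro]: "a \<in> carrier M"
    and b_closed [simp, intro]: "b \<in> carrier M"
    and ab: "a \<otimes> b \<noteq> b \<otimes> a"
begin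

definition zt where "zt = a \<otimes> b \<otimes> inv a \<otimes> inv b"

lemma finite_M: "finite (carrier M)"
  using card_M prime_q by (metis card.infinite not_prime_0 power_not_zero)

lemma commutator_center:
  assumes "x \<in> carrier M" "y \<in> carrier M"
  shows "x \<otimes> y \<otimes> inv x \<otimes> inv y \<in> grp_center M"
  unfolding derived_M[symmetric] derived_def using assms by (intro generate.incl) blast

lemma zt_center: "zt \<in> grp_center M"
  unfolding zt_def by (rule commutator_center) auto

lemma zt_closed [simp, intro]: "zt \<in> carrier M"
  using zt_center by (simp add: grp_center_def)

lemma zt_pow_center: "zt [^] (k::int) \<in> grp_center M"
proof -
  have "subgroup (derived M (carrier M)) M" by (simp add: derived_is_subgroup)
  then show ?thesis using zt_center derived_M subgroup_int_pow_closed by metis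
qed

lemma zt_comm: "x \<in> carrier M \<Longrightarrow> zt [^] (k::int) \<otimes> x = x \<otimes> zt [^] k"
  using zt_pow_center by (auto simp: grp_center_def)

lemma zt_ne_one: "zt \<noteq> \<one>"
proof
  assume "zt = \<one>"
  then have "a \<otimes> b \<otimes> inv a \<otimes> inv b \<otimes> b \<otimes> a = b \<otimes> a" by (simp add: zt_def)
  then show False using ab by (simp add: m_assoc)
qed

text \<open>The centre has prime order, so the nontrivial subgroup generated by \<open>zt\<close> is
  all of it. Central elements are thus recorded by integer exponents.\<close>

lemma ord_zt: "ord zt = q"
  and center_eq: "grp_center M = range (\<lambda>k::int. zt [^] k)"
proof -
  have sub: "subgroup (grp_center M) M" using derived_is_subgroup derived_M by (metis order_refl)
  have gen: "generate M {zt} \<subseteq> grp_center M"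
    using sub zt_center by (simp add: generate_subgroup_incl)
  have fin: "finite (grp_center M)" using card_center prime_q by (metis card.infinite not_prime_0)
  interpret Z: group "M\<lparr>carrier := grp_center M\<rparr>" by (rule subgroup_imp_group[OF sub])
  have "subgroup (generate M {zt}) (M\<lparr>carrier := grp_center M\<rparr>)"
    using gen sub by (intro subgroup_incl) (auto intro: generate_is_subgroup)
  from Z.lagrange[OF this] have "card (generate M {zt}) dvd order (M\<lparr>carrier := grp_center M\<rparr>)"
    by (rule dvdI[OF trans[OF sym mult.commute]])
  then have "card (generate M {zt}) dvd q" by (simp add: order_def card_center)
  moreover have "card (generate M {zt}) \<noteq> 1"
  proof
    assume "card (generate M {zt}) = 1"
    then obtain y where "generate M {zt} = {y}" by (auto simp: card_1_singleton_iff)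
    moreover have "zt \<in> generate M {zt}" "\<one> \<in> generate M {zt}" by (auto intro: generate.intros)
    ultimately show False using zt_ne_one by auto
  qed
  ultimately have c: "card (generate M {zt}) = q" using prime_q by (auto simp: prime_nat_iff)
  then show "ord zt = q" using generate_pow_card by simp
  have "generate M {zt} = grp_center M"
    using c card_center gen fin by (simp add: card_subset_eq)
  then show "grp_center M = range (\<lambda>k::int. zt [^] k)"
    by (auto simp: generate_pow)
qed

lemma zt_pow_one_iff: "zt [^] (k::int) = \<one> \<longleftrightarrow> int q dvd k"
  using int_pow_eq_id[of zt k] ord_zt by simp

lemma zt_pow_cong: "int q dvd k - l \<Longrightarrow> zt [^] (k::int) = zt [^] (l::int)"
  using int_pow_eq[of zt l k] ord_zt by simp

lemma conj_pow: 
  assumes "x \<in> carrier M" "y \<in> carrier M"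
  shows "(x \<otimes> y \<otimes> inv x) [^] (n::int) = x \<otimes> y [^] n \<otimes> inv x"
proof -
  have h: "(\<lambda>y. x \<otimes> y \<otimes> inv x) \<in> hom M M"
    using assms by (auto simp: hom_def m_assoc inv_solve_left)
  show ?thesis using hom_int_pow[OF h assms(2) is_group is_group] by simp
qed

text \<open>Conjugation is a homomorphism and \<open>zt\<close> is central, so
  \<open>conj_pow\<close> applies first to powers of \<open>y\<close> and then to powers of
  \<open>x\<close>.\<close>

lemma pow_comm:
  assumes [simp]: "x \<in> carrier M" "y \<in> carrier M" and xy: "x \<otimes> y \<otimes> inv x \<otimes> inv y = zt [^] (j::int)"
  shows "y [^] (e::int) \<otimes> x [^] (n::int) = zt [^] (- j * e * n) \<otimes> x [^] n \<otimes> y [^] e"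
proof -
  have 1: "x \<otimes> y \<otimes> inv x = zt [^] j \<otimes> y" by (simp add: xy[symmetric] m_assoc)
  have zb: "zt [^] j \<otimes> y = y \<otimes> zt [^] j" using zt_comm by simp
  have "x \<otimes> y [^] e \<otimes> inv x = zt [^] (j * e) \<otimes> y [^] e"
    using conj_pow[of x y e] 1 int_pow_mult_distrib[OF zb] by (simp add: int_pow_pow)
  then have 2: "x \<otimes> y [^] e = zt [^] (j * e) \<otimes> y [^] e \<otimes> x"
    by (metis inv_solve_right' assms(1,2) int_pow_closed m_closed zt_closed)
  have "y [^] e \<otimes> x = zt [^] (- j * e) \<otimes> (x \<otimes> y [^] e)"
    by (simp add: 2 m_assoc int_pow_neg) (simp flip: m_assoc)
  then have 3: "y [^] e \<otimes> x \<otimes> inv (y [^] e) = zt [^] (- j * e) \<otimes> x"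
    by (simp add: m_assoc)
  have za: "zt [^] (- j * e) \<otimes> x = x \<otimes> zt [^] (- j * e)" by (rule zt_comm) simp
  have "y [^] e \<otimes> x [^] n \<otimes> inv (y [^] e) = (zt [^] (- j * e) \<otimes> x) [^] n"
    using conj_pow[of "y [^] e" x n] 3 by simp
  also have "\<dots> = zt [^] (- j * e * n) \<otimes> x [^] n"
    using int_pow_mult_distrib[OF za] by (simp add: int_pow_pow)
  finally show ?thesis by (metis inv_solve_right' assms(1,2) int_pow_closed m_closed zt_closed)
qed

lemma b_pow_a_pow: "b [^] (e::int) \<otimes> a [^] (n::int) = zt [^] (- e * n) \<otimes> a [^] n \<otimes> b [^] e"
  using pow_comm[of a b 1 e n] by (simp add: zt_def)

text \<open>The commutator of \<open>a^n\<close> with \<open>x\<close> is the \<open>n\<close>-th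
  power of a central commutator, hence trivial if \<open>q\<close> divides \<open>n\<close>; with
  \<open>b\<close> it is \<open>zt^n\<close>, which gives the converse.\<close>

lemma a_pow_center_iff: "a [^] (n::int) \<in> grp_center M \<longleftrightarrow> int q dvd n"
proof
  assume "a [^] n \<in> grp_center M"
  then have "a [^] n \<otimes> b = zt [^] (-n) \<otimes> a [^] n \<otimes> b"
    using b_pow_a_pow[of 1 n] by (simp add: grp_center_def)
  then have "zt [^] (-n) = \<one>" by (simp add: m_assoc)
  then show "int q dvd n" using zt_pow_one_iff by simp
next
  assume n: "int q dvd n"
  have "a [^] n \<otimes> x = x \<otimes> a [^] n" if x: "x \<in> carrier M" for x
  proof -
    obtain j :: int where j: "a \<otimes> x \<otimes> inv a \<otimes> inv x = zt [^] j"
      using commutator_center[OF a_closed x] center_eq by auto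
    have "zt [^] (- j * 1 * n) = \<one>" using n by (subst zt_pow_one_iff) auto
    then show ?thesis using pow_comm[OF a_closed x j, of 1 n] x by simp
  qed
  then show "a [^] n \<in> grp_center M" by (auto simp: grp_center_def)
qed

end

lemma extra_special_ncomm_pair:
  assumes "extra_special M q"
  obtains m a b where "ncomm_pair M q m a b"
proof -
  have M: "group M" "prime q" "derived M (carrier M) = grp_center M" "card (grp_center M) = q"
    using assms by (auto simp: extra_special_def)
  interpret M: group M by fact
  obtain m where m: "card (carrier M) = q ^ m" using assms by (auto simp: extra_special_def)
  have "\<exists>a\<in>carrier M. \<exists>b\<in>carrier M. a \<otimes>\<^bsub>M\<^esub> b \<noteq> b \<otimes>\<^bsub>M\<^esub> a"
  proof (rule ccontr)
    assume "\<not> ?thesis"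
    then have "comm_group M" by (intro M.group_comm_groupI) blast
    then have "derived M (carrier M) = {\<one>\<^bsub>M\<^esub>}" by (simp add: comm_group.derived_eq_singleton)
    then show False using M prime_gt_1_nat[of q] by simp
  qed
  then obtain a b where "ncomm_pair M q m a b"
    using M m by (auto simp: ncomm_pair_def ncomm_pair_axioms_def)
  then show ?thesis by (rule that)
qed

section \<open>The base group of the wreath product and its quotient\<close>

text \<open>Here \<open>H\<close> and \<open>R\<close> stand for \<open>G_{i-1}\<close> and
  \<open>R_{i-1}\<close>, and \<open>q\<close> for \<open>p_i\<close>; the primes
  \<open>card R\<close> and \<open>q\<close> differ because consecutive primes of the sequence
  do.\<close>

locale wreath_base = ncomm_pair M q m a b + G: group G
  for M :: "('m, 'c) monoid_scheme" (structure) and q m a b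
    and G :: "('g, 'd) monoid_scheme" +
  fixes H R :: "'g set"
  assumes H_sub: "subgroup H G" and finite_H: "finite H"
    and R_sub: "subgroup R G" and R_H: "R \<subseteq> H"
    and R_normal: "\<And>h x. h \<in> H \<Longrightarrow> x \<in> R \<Longrightarrow> inv\<^bsub>G\<^esub> h \<otimes>\<^bsub>G\<^esub> x \<otimes>\<^bsub>G\<^esub> h \<in> R"
    and prime_card_R: "prime (card R)" and card_R_ne: "card R \<noteq> q"
begin

abbreviation "B \<equiv> base_group H M"
abbreviation "N \<equiv> wr_N G H M"
abbreviation act (infixl "\<star>" 75) where "f \<star> h \<equiv> reg_act G H f h"

text \<open>Integer exponents make the coding additive, at the price of injectivity; for
  \<open>zf\<close> the ambiguity is exactly congruence modulo \<open>q\<close>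
  (\<open>zf_eq_iff\<close>).\<close>

definition F :: "('g \<Rightarrow> int) \<Rightarrow> ('g \<Rightarrow> int) \<Rightarrow> 'g \<Rightarrow> 'm"
  where "F n k = (\<lambda>x\<in>H. a [^] n x \<otimes> zt [^] k x)"
definition zf :: "('g \<Rightarrow> int) \<Rightarrow> 'g \<Rightarrow> 'm"
  where "zf k = (\<lambda>x\<in>H. zt [^] k x)"
definition bf :: "('g \<Rightarrow> int) \<Rightarrow> 'g \<Rightarrow> 'm"
  where "bf e = (\<lambda>x\<in>H. b [^] e x)"

lemma H_closed [simp]: "x \<in> H \<Longrightarrow> y \<in> H \<Longrightarrow> x \<otimes>\<^bsub>G\<^esub> y \<in> H"
  and H_inv [simp]: "x \<in> H \<Longrightarrow> inv\<^bsub>G\<^esub> x \<in> H"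
  and H_one [simp]: "\<one>\<^bsub>G\<^esub> \<in> H"
  and H_carrier [simp]: "x \<in> H \<Longrightarrow> x \<in> carrier G"
  and R_imp_H [simp]: "x \<in> R \<Longrightarrow> x \<in> H"
  using H_sub R_H by (auto dest: subgroup.m_closed subgroup.m_inv_closed subgroup.one_closed subgroup.mem_carrier)

lemma R_one [simp]: "\<one>\<^bsub>G\<^esub> \<in> R"
  and R_inv [simp]: "x \<in> R \<Longrightarrow> inv\<^bsub>G\<^esub> x \<in> R"
  using R_sub by (auto dest: subgroup.m_inv_closed subgroup.one_closed)

lemma carrier_B: "carrier B = (\<Pi>\<^sub>E x\<in>H. carrier M)"
  and mult_B: "f \<otimes>\<^bsub>B\<^esub> g = (\<lambda>x\<in>H. f x \<otimes> g x)"
  and one_B: "\<one>\<^bsub>B\<^esub> = (\<lambda>x\<in>H. \<one>)"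
  by (simp_all add: base_group_def)

lemma inv_B: "f \<in> carrier B \<Longrightarrow> inv\<^bsub>B\<^esub> f = (\<lambda>x\<in>H. inv (f x))"
  unfolding base_group_def by (subst inv_product_group) (auto simp: is_group)

sublocale B: group B
  unfolding base_group_def by (rule product_group) (rule is_group)

lemma B_app [simp]: "f \<in> carrier B \<Longrightarrow> x \<in> H \<Longrightarrow> f x \<in> carrier M"
  by (auto simp: carrier_B)

lemma F_closed [simp]: "F n k \<in> carrier B"
  and zf_closed [simp]: "zf k \<in> carrier B"
  and bf_closed [simp]: "bf k \<in> carrier B"
  by (auto simp: carrier_B F_def zf_def bf_def)

lemma zf_eq_F: "zf k = F (\<lambda>_. 0) k"
  by (auto simp: zf_def F_def)

lemma F_mult: "F n k \<otimes>\<^bsub>B\<^esub> F n' k' = F (\<lambda>x. n x + n' x) (\<lambda>x. k x + k' x)"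
proof -
  have "a [^] n x \<otimes> zt [^] k x \<otimes> (a [^] n' x \<otimes> zt [^] k' x)
    = a [^] (n x + n' x) \<otimes> zt [^] (k x + k' x)" for x
    using zt_comm[of "a [^] n' x" "k x"] by (simp add: int_pow_mult m_assoc) (simp flip: m_assoc)
  then show ?thesis by (auto simp: mult_B F_def)
qed

lemma F_one: "\<one>\<^bsub>B\<^esub> = F (\<lambda>_. 0) (\<lambda>_. 0)"
  by (auto simp: one_B F_def)

lemma F_inv: "inv\<^bsub>B\<^esub> (F n k) = F (\<lambda>x. - n x) (\<lambda>x. - k x)"
  by (rule B.inv_equality) (auto simp: F_mult F_one)

lemma zf_mult: "zf k \<otimes>\<^bsub>B\<^esub> zf k' = zf (\<lambda>x. k x + k' x)"
  and zf_inv: "inv\<^bsub>B\<^esub> (zf k) = zf (\<lambda>x. - k x)"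
  and zf_one: "\<one>\<^bsub>B\<^esub> = zf (\<lambda>_. 0)"
  by (simp_all add: zf_eq_F F_mult F_inv F_one)

lemma zf_cong: "(\<And>x. x \<in> H \<Longrightarrow> int q dvd k x - l x) \<Longrightarrow> zf k = zf l"
  unfolding zf_def by (intro restrict_ext zt_pow_cong)

lemma act_closed [simp]: "f \<in> carrier B \<Longrightarrow> h \<in> H \<Longrightarrow> f \<star> h \<in> carrier B"
  unfolding carrier_B reg_act_def by auto

lemma act_F: "h \<in> H \<Longrightarrow> F n k \<star> h = F (\<lambda>x. n (x \<otimes>\<^bsub>G\<^esub> inv\<^bsub>G\<^esub> h)) (\<lambda>x. k (x \<otimes>\<^bsub>G\<^esub> inv\<^bsub>G\<^esub> h))"
  by (auto simp: F_def reg_act_def)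

lemma act_zf: "h \<in> H \<Longrightarrow> zf k \<star> h = zf (\<lambda>x. k (x \<otimes>\<^bsub>G\<^esub> inv\<^bsub>G\<^esub> h))"
  by (simp add: zf_eq_F act_F)

lemma act_mult: "h \<in> H \<Longrightarrow> (f \<otimes>\<^bsub>B\<^esub> g) \<star> h = (f \<star> h) \<otimes>\<^bsub>B\<^esub> (g \<star> h)"
  by (auto simp: mult_B reg_act_def)

lemma act_inv: "f \<in> carrier B \<Longrightarrow> h \<in> H \<Longrightarrow> inv\<^bsub>B\<^esub> (f \<star> h) = (inv\<^bsub>B\<^esub> f) \<star> h"
  by (simp add: inv_B) (auto simp: reg_act_def)

lemma act_act: "g \<in> H \<Longrightarrow> h \<in> H \<Longrightarrow> (f \<star> g) \<star> h = f \<star> (g \<otimes>\<^bsub>G\<^esub> h)"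
  by (auto simp: reg_act_def G.inv_mult_group G.m_assoc)

lemma act_one: "f \<in> carrier B \<Longrightarrow> f \<star> \<one>\<^bsub>G\<^esub> = f"
  by (auto simp: reg_act_def carrier_B fun_eq_iff PiE_iff extensional_def)

lemma sum_translate: 
  fixes k :: "'g \<Rightarrow> int"
  assumes "h \<in> H" shows "(\<Sum>x\<in>H. k (x \<otimes>\<^bsub>G\<^esub> h)) = (\<Sum>x\<in>H. k x)"
  by (rule sum.reindex_bij_witness[of _ "\<lambda>x. x \<otimes>\<^bsub>G\<^esub> inv\<^bsub>G\<^esub> h" "\<lambda>x. x \<otimes>\<^bsub>G\<^esub> h"])
    (use assms in \<open>auto simp: G.m_assoc\<close>)

lemma commutator_zf:
  assumes f: "f \<in> carrier B" and g: "g \<in> carrier B"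
  shows "\<exists>k. f \<otimes>\<^bsub>B\<^esub> g \<otimes>\<^bsub>B\<^esub> inv\<^bsub>B\<^esub> f \<otimes>\<^bsub>B\<^esub> inv\<^bsub>B\<^esub> g = zf k"
proof -
  have "\<forall>x\<in>H. \<exists>k::int. f x \<otimes> g x \<otimes> inv (f x) \<otimes> inv (g x) = zt [^] k"
  proof
    fix x assume "x \<in> H"
    then have "f x \<otimes> g x \<otimes> inv (f x) \<otimes> inv (g x) \<in> grp_center M"
      using f g by (intro commutator_center) auto
    then show "\<exists>k::int. f x \<otimes> g x \<otimes> inv (f x) \<otimes> inv (g x) = zt [^] k"
      unfolding center_eq by blast
  qed
  from bchoice[OF this] obtain k :: "'g \<Rightarrow> int"
    where "\<forall>x\<in>H. f x \<otimes> g x \<otimes> inv (f x) \<otimes> inv (g x) = zt [^] k x" by blast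
  then have "f \<otimes>\<^bsub>B\<^esub> g \<otimes>\<^bsub>B\<^esub> inv\<^bsub>B\<^esub> f \<otimes>\<^bsub>B\<^esub> inv\<^bsub>B\<^esub> g = zf k"
    using f g by (simp add: mult_B inv_B zf_def cong: restrict_cong)
  then show ?thesis by blast
qed

text \<open>Modulo \<open>N\<close> only the sum of the exponents survives (\<open>zf_in_N\<close>),
  so commutation turns into a bilinear pairing of \<open>e\<close> and \<open>n\<close>, which
  \<open>noncommuting\<close> evaluates.\<close>

lemma commutator_bf_F:
  "bf e \<otimes>\<^bsub>B\<^esub> F n k \<otimes>\<^bsub>B\<^esub> inv\<^bsub>B\<^esub> (bf e) \<otimes>\<^bsub>B\<^esub> inv\<^bsub>B\<^esub> (F n k) = zf (\<lambda>x. - e x * n x)"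
proof -
  have "b [^] e x \<otimes> (a [^] n x \<otimes> zt [^] k x) \<otimes> inv (b [^] e x) \<otimes> inv (a [^] n x \<otimes> zt [^] k x)
    = zt [^] (- e x * n x)" for x
  proof -
    have "b [^] e x \<otimes> (a [^] n x \<otimes> zt [^] k x) = (zt [^] (- e x * n x) \<otimes> a [^] n x \<otimes> b [^] e x) \<otimes> zt [^] k x"
      using b_pow_a_pow[of "e x" "n x"] by (simp flip: m_assoc)
    also have "\<dots> = zt [^] (- e x * n x) \<otimes> (a [^] n x \<otimes> zt [^] k x) \<otimes> b [^] e x"
      using zt_comm[of "b [^] e x" "k x"] by (simp add: m_assoc)
    finally show ?thesis by (simp add: m_assoc)
  qed
  then show ?thesis
    using F_closed[of n k] bf_closed[of e] by (auto simp: mult_B inv_B zf_def F_def bf_def)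
qed

lemma bf_diff: "h \<in> H \<Longrightarrow> inv\<^bsub>B\<^esub> (bf e) \<otimes>\<^bsub>B\<^esub> (bf e \<star> h) = bf (\<lambda>x. e (x \<otimes>\<^bsub>G\<^esub> inv\<^bsub>G\<^esub> h) - e x)"
proof -
  assume h: "h \<in> H"
  have "inv (b [^] (i::int)) \<otimes> b [^] (j::int) = b [^] (j - i)" for i j
    using int_pow_mult[of b "-i" j] by (simp add: int_pow_neg)
  then show ?thesis
    using h bf_closed[of e] by (auto simp: mult_B inv_B bf_def reg_act_def)
qed

lemma zf_comm: "f \<in> carrier B \<Longrightarrow> zf k \<otimes>\<^bsub>B\<^esub> f = f \<otimes>\<^bsub>B\<^esub> zf k"
  by (auto simp: mult_B zf_def zt_comm)

section \<open>Identification of \<open>N\<close> with the kernel of the exponent sum modulo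
  \<open>q\<close>\<close>

lemma zf_eq_iff: "zf k = zf l \<longleftrightarrow> (\<forall>x\<in>H. int q dvd k x - l x)"
proof
  assume *: "zf k = zf l"
  show "\<forall>x\<in>H. int q dvd k x - l x"
  proof
    fix x assume "x \<in> H"
    then have "zt [^] k x = zt [^] l x" using fun_cong[OF *, of x] by (simp add: zf_def)
    then show "int q dvd k x - l x" using int_pow_eq[of zt "l x" "k x"] ord_zt by simp
  qed
qed (simp add: zf_cong)

definition N0 where "N0 = {zf k | k. int q dvd (\<Sum>x\<in>H. k x)}"

text \<open>Exponents are determined modulo \<open>q\<close>, so divisibility of their sum does not
  depend on the choice of \<open>k\<close>.\<close>

lemma zf_in_N0: "zf k \<in> N0 \<longleftrightarrow> int q dvd (\<Sum>x\<in>H. k x)"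
proof
  assume "zf k \<in> N0"
  then obtain l where l: "zf k = zf l" "int q dvd (\<Sum>x\<in>H. l x)" by (auto simp: N0_def)
  then have "int q dvd (\<Sum>x\<in>H. k x - l x)" by (intro dvd_sum) (auto simp: zf_eq_iff)
  then show "int q dvd (\<Sum>x\<in>H. k x)" using l(2) by (simp add: sum_subtractf dvd_diff_left_iff)
qed (auto simp: N0_def)

lemma N0_sub: "subgroup N0 B"
proof (rule B.subgroupI)
  have "zf (\<lambda>_. 0) \<in> N0" by (simp add: zf_in_N0)
  then show "N0 \<noteq> {}" by blast
qed (auto simp: N0_def zf_inv zf_mult sum.distrib sum_negf zf_in_N0[unfolded N0_def, simplified])

text \<open>Commutators are pointwise central, which gives one inclusion; conversely
  \<open>zf k\<close> is a single commutator, of the constant function \<open>b\<close> with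
  \<open>a\<close> raised to \<open>- k\<close>.\<close>

lemma derived_B: "derived B (carrier B) = range zf"
proof
  have "subgroup (range zf) B"
    by (rule B.subgroupI) (auto simp: zf_inv zf_mult)
  then show "derived B (carrier B) \<subseteq> range zf"
    unfolding derived_def by (intro B.generate_subgroup_incl) (use commutator_zf in blast)+
  show "range zf \<subseteq> derived B (carrier B)"
  proof
    fix f assume "f \<in> range zf"
    then obtain k where k: "f = zf k" by auto
    have "f = bf (\<lambda>_. 1) \<otimes>\<^bsub>B\<^esub> F (\<lambda>x. - k x) (\<lambda>_. 0) \<otimes>\<^bsub>B\<^esub> inv\<^bsub>B\<^esub> (bf (\<lambda>_. 1)) \<otimes>\<^bsub>B\<^esub> inv\<^bsub>B\<^esub> (F (\<lambda>x. - k x) (\<lambda>_. 0))"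
      unfolding commutator_bf_F k by simp
    then show "f \<in> derived B (carrier B)"
      unfolding derived_def
      by (elim ssubst, intro generate.incl) (rule UN_I, rule bf_closed, rule UN_I, rule F_closed, rule singletonI)
  qed
qed

text \<open>Translation preserves exponent sums. Conversely, differences of point masses at
  \<open>x\<close> and at the identity generate the functions of sum zero, as for an augmentation
  ideal.\<close>

lemma wr_N_eq: "N = N0"
proof
  show "N \<subseteq> N0"
    unfolding wr_N_def act_comm_def derived_B
  proof (rule B.generate_subgroup_incl[OF _ N0_sub], clarify)
    fix k h assume h: "h \<in> H"
    show "inv\<^bsub>B\<^esub> (zf k) \<otimes>\<^bsub>B\<^esub> (zf k \<star> h) \<in> N0"
      using h sum_translate[of "inv\<^bsub>G\<^esub> h" k]
      by (simp add: act_zf zf_inv zf_mult zf_in_N0 sum_subtractf)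
  qed
  have sub: "subgroup N B"
    unfolding wr_N_def act_comm_def derived_B by (rule B.generate_is_subgroup) auto
  define dl where "dl x y = (if y = x then 1 else 0 :: int)" for x y :: 'g
  have gen: "zf (\<lambda>y. c * (dl x y - dl \<one>\<^bsub>G\<^esub> y)) \<in> N" if x: "x \<in> H" for x c
  proof -
    \<comment> \<open>Translation by \<open>x\<close> moves a point mass from the identity to
      \<open>x\<close>.\<close>
    let ?k = "\<lambda>y. c * dl \<one>\<^bsub>G\<^esub> y"
    have "inv\<^bsub>B\<^esub> (zf ?k) \<otimes>\<^bsub>B\<^esub> (zf ?k \<star> x) \<in> N"
      unfolding wr_N_def act_comm_def derived_B by (rule generate.incl) (use x in auto)
    moreover have "dl \<one>\<^bsub>G\<^esub> (y \<otimes>\<^bsub>G\<^esub> inv\<^bsub>G\<^esub> x) = dl x y" if "y \<in> H" for y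
      using that x by (auto simp: dl_def G.inv_equality G.inv_solve_right')
    then have "inv\<^bsub>B\<^esub> (zf ?k) \<otimes>\<^bsub>B\<^esub> (zf ?k \<star> x) = zf (\<lambda>y. c * (dl x y - dl \<one>\<^bsub>G\<^esub> y))"
      using x by (auto simp: act_zf zf_inv zf_mult algebra_simps intro!: zf_cong)
    ultimately show ?thesis by simp
  qed
  have fin: "zf (\<lambda>y. \<Sum>x\<in>S. k x * (dl x y - dl \<one>\<^bsub>G\<^esub> y)) \<in> N" if "S \<subseteq> H" for S k
    using finite_subset[OF that finite_H] that
  proof induction
    case empty
    show ?case using sub by (simp add: subgroup.one_closed flip: zf_one)
  next
    case (insert x S)
    then show ?case using gen[of x "k x"] subgroup.m_closed[OF sub] by (fastforce simp: zf_mult)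
  qed
  show "N0 \<subseteq> N"
  proof
    fix f assume "f \<in> N0"
    then obtain k where k: "f = zf k" "int q dvd (\<Sum>x\<in>H. k x)" by (auto simp: N0_def)
    \<comment> \<open>Subtracting the total mass at the identity changes \<open>k\<close> only by a
      multiple of \<open>q\<close>.\<close>
    have "f = zf (\<lambda>y. \<Sum>x\<in>H. k x * (dl x y - dl \<one>\<^bsub>G\<^esub> y))"
      unfolding k
    proof (rule zf_cong)
      fix y assume y: "y \<in> H"
      have "(\<Sum>x\<in>H. k x * (dl x y - dl \<one>\<^bsub>G\<^esub> y)) = k y - (\<Sum>x\<in>H. k x) * dl \<one>\<^bsub>G\<^esub> y"
        using y finite_H by (simp add: right_diff_distrib sum_subtractf sum_distrib_right dl_def sum.delta' cong: if_cong)
          (simp add: if_distrib sum.delta' cong: if_cong)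
      then show "int q dvd k y - (\<Sum>x\<in>H. k x * (dl x y - dl \<one>\<^bsub>G\<^esub> y))"
        using k(2) by simp
    qed
    then show "f \<in> N" using fin by simp
  qed
qed

lemma zf_in_N: "zf k \<in> N \<longleftrightarrow> int q dvd (\<Sum>x\<in>H. k x)"
  by (simp add: wr_N_eq zf_in_N0)

lemma N_normal: "N \<lhd> B"
  unfolding B.normal_inv_iff using N0_sub
  by (auto simp: wr_N_eq N0_def zf_comm[symmetric] B.m_assoc)

sublocale N: normal N B by (rule N_normal)

lemma act_N: "f \<in> N \<Longrightarrow> h \<in> H \<Longrightarrow> f \<star> h \<in> N"
  unfolding wr_N_eq by (auto simp: N0_def act_zf) (metis sum_translate H_inv)

text \<open>\<open>N\<close> is stable under \<open>h\<close> and its inverse, so the elementwise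
  image of a coset is a full coset.\<close>

lemma coset_act_eq:
  assumes f: "f \<in> carrier B" and h: "h \<in> H"
  shows "coset_act G H (N #>\<^bsub>B\<^esub> f) h = N #>\<^bsub>B\<^esub> (f \<star> h)"
proof
  show "coset_act G H (N #>\<^bsub>B\<^esub> f) h \<subseteq> N #>\<^bsub>B\<^esub> (f \<star> h)"
  proof
    fix g assume "g \<in> coset_act G H (N #>\<^bsub>B\<^esub> f) h"
    then obtain n where n: "n \<in> N" "g = (n \<otimes>\<^bsub>B\<^esub> f) \<star> h" by (auto simp: coset_act_def r_coset_def)
    then have "n \<star> h \<in> N" "g = (n \<star> h) \<otimes>\<^bsub>B\<^esub> (f \<star> h)" using h by (simp_all add: act_N act_mult)
    then show "g \<in> N #>\<^bsub>B\<^esub> (f \<star> h)" unfolding r_coset_def by blast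
  qed
  show "N #>\<^bsub>B\<^esub> (f \<star> h) \<subseteq> coset_act G H (N #>\<^bsub>B\<^esub> f) h"
  proof
    fix g assume "g \<in> N #>\<^bsub>B\<^esub> (f \<star> h)"
    then obtain n where n: "n \<in> N" "g = n \<otimes>\<^bsub>B\<^esub> (f \<star> h)" by (auto simp: r_coset_def)
    have "n \<in> carrier B" using n N.subset by blast
    then have "g = ((n \<star> inv\<^bsub>G\<^esub> h) \<otimes>\<^bsub>B\<^esub> f) \<star> h"
      using n h by (simp add: act_mult act_act act_one)
    moreover have "n \<star> inv\<^bsub>G\<^esub> h \<in> N" using n h act_N by simp
    ultimately show "g \<in> coset_act G H (N #>\<^bsub>B\<^esub> f) h"
      by (auto simp: coset_act_def r_coset_def)
  qed
qed

lemma finite_B: "finite (carrier B)"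
  unfolding carrier_B by (intro finite_PiE finite_H finite_M)

lemma card_B: "card (carrier B) = q ^ (m * card H)"
  unfolding carrier_B by (simp add: card_PiE finite_H card_M power_mult)

end

section \<open>One step of the construction\<close>

lemma exists_mult_cong_prime:
  assumes "prime q" "\<not> int q dvd c"
  shows "\<exists>n::nat. int q dvd int n * c - s"
proof -
  have "coprime c (int q)" using assms prime_imp_coprime[of "int q" c] by (simp add: coprime_commute)
  then obtain x where x: "[c * x = 1] (mod int q)" using cong_solve_coprime_int by blast
  have q0: "int q > 0" using assms(1) prime_gt_0_nat by simp
  have "[c * x * s = 1 * s] (mod int q)" using x by (rule cong_scalar_right)
  then have "[c * (x * s mod int q) = s] (mod int q)"
    by (metis cong_def mod_mult_right_eq mult.assoc mult_1)
  then have "int q dvd int (nat (x * s mod int q)) * c - s"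
    using q0 by (simp add: cong_iff_dvd_diff mult.commute)
  then show ?thesis by blast
qed

locale wreath_step = wreath_base M q m a b G H R
  for M :: "('m, 'c) monoid_scheme" (structure) and q m a b
    and G :: "('g, 'd) monoid_scheme" and H R +
  fixes D Gi :: "'g set" and \<phi> :: "'g \<Rightarrow> ('g \<Rightarrow> 'm) set"
  assumes D_sub: "subgroup D G"
    and D_normal: "\<And>g d. g \<in> Gi \<Longrightarrow> d \<in> D \<Longrightarrow> inv\<^bsub>G\<^esub> g \<otimes>\<^bsub>G\<^esub> d \<otimes>\<^bsub>G\<^esub> g \<in> D"
    and Gi_sub: "subgroup Gi G"
    and DH: "D <#>\<^bsub>G\<^esub> H = Gi"
    and phi_bij: "bij_betw \<phi> D (wr_D G H R M)"
    and phi_mult: "\<And>x y. x \<in> D \<Longrightarrow> y \<in> D \<Longrightarrow> \<phi> (x \<otimes>\<^bsub>G\<^esub> y) = \<phi> x \<otimes>\<^bsub>wr_Bq G H M\<^esub> \<phi> y"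
    and phi_act: "\<And>d g. d \<in> D \<Longrightarrow> g \<in> H \<Longrightarrow> \<phi> (inv\<^bsub>G\<^esub> g \<otimes>\<^bsub>G\<^esub> d \<otimes>\<^bsub>G\<^esub> g) = coset_act G H (\<phi> d) g"
begin

section \<open>Calculation with representatives modulo \<open>N\<close>\<close>

abbreviation "Bq \<equiv> wr_Bq G H M"

sublocale Bq: group Bq
  unfolding wr_Bq_def by (rule N.factorgroup_is_group)

lemma carrier_Bq: "carrier Bq = (\<lambda>f. N #>\<^bsub>B\<^esub> f) ` carrier B"
  by (simp add: wr_Bq_def carrier_FactGroup)

lemma mult_Bq: "f \<in> carrier B \<Longrightarrow> g \<in> carrier B
   \<Longrightarrow> (N #>\<^bsub>B\<^esub> f) \<otimes>\<^bsub>Bq\<^esub> (N #>\<^bsub>B\<^esub> g) = N #>\<^bsub>B\<^esub> (f \<otimes>\<^bsub>B\<^esub> g)"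
  by (simp add: wr_Bq_def N.rcos_sum)

lemma inv_Bq: "f \<in> carrier B \<Longrightarrow> inv\<^bsub>Bq\<^esub> (N #>\<^bsub>B\<^esub> f) = N #>\<^bsub>B\<^esub> (inv\<^bsub>B\<^esub> f)"
  unfolding wr_Bq_def by (subst N.inv_FactGroup) (auto simp: carrier_FactGroup N.rcos_inv)

text \<open>Representatives \<open>f\<close> in place of cosets expose the shape
  \<open>f^-1 f^r\<close> of the generators, which telescopes in
  \<open>D_subset_normal\<close>.\<close>

lemma wr_D_gen: "wr_D G H R M = generate Bq {N #>\<^bsub>B\<^esub> (inv\<^bsub>B\<^esub> f \<otimes>\<^bsub>B\<^esub> (f \<star> r)) | f r. f \<in> carrier B \<and> r \<in> R}"
proof -
  have "{inv\<^bsub>Bq\<^esub> x \<otimes>\<^bsub>Bq\<^esub> coset_act G H x r | x r. x \<in> carrier Bq \<and> r \<in> R}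
     = {N #>\<^bsub>B\<^esub> (inv\<^bsub>B\<^esub> f \<otimes>\<^bsub>B\<^esub> (f \<star> r)) | f r. f \<in> carrier B \<and> r \<in> R}" (is "?L = ?R")
  proof -
    have *: "inv\<^bsub>Bq\<^esub> (N #>\<^bsub>B\<^esub> f) \<otimes>\<^bsub>Bq\<^esub> coset_act G H (N #>\<^bsub>B\<^esub> f) r = N #>\<^bsub>B\<^esub> (inv\<^bsub>B\<^esub> f \<otimes>\<^bsub>B\<^esub> (f \<star> r))"
      if "f \<in> carrier B" "r \<in> R" for f r
      using that by (simp add: coset_act_eq inv_Bq mult_Bq)
    show ?thesis
    proof
      show "?L \<subseteq> ?R" unfolding carrier_Bq using * by fast
      show "?R \<subseteq> ?L" unfolding carrier_Bq using * by (smt (verit) Collect_mono_iff imageI)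
    qed
  qed
  then show ?thesis by (simp add: wr_D_def act_comm_def)
qed

lemma wr_D_sub: "subgroup (wr_D G H R M) Bq"
  unfolding wr_D_gen by (rule Bq.generate_is_subgroup) (auto simp: carrier_Bq)

text \<open>A relation rather than a function: \<open>f\<close> determines \<open>d\<close>, but
  \<open>d\<close> determines \<open>f\<close> only modulo \<open>N\<close>.\<close>

definition lift :: "('g \<Rightarrow> 'm) \<Rightarrow> 'g \<Rightarrow> bool"
  where "lift f d \<longleftrightarrow> d \<in> D \<and> f \<in> carrier B \<and> \<phi> d = N #>\<^bsub>B\<^esub> f"

lemma lift_D: "lift f d \<Longrightarrow> d \<in> D"
  and lift_B: "lift f d \<Longrightarrow> f \<in> carrier B"
  by (auto simp: lift_def)

lemma D_carrier [simp]: "d \<in> D \<Longrightarrow> d \<in> carrier G"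
  and D_one [simp]: "\<one>\<^bsub>G\<^esub> \<in> D"
  and D_inv [simp]: "d \<in> D \<Longrightarrow> inv\<^bsub>G\<^esub> d \<in> D"
  and D_mult [simp]: "d \<in> D \<Longrightarrow> e \<in> D \<Longrightarrow> d \<otimes>\<^bsub>G\<^esub> e \<in> D"
  using D_sub by (auto dest: subgroup.m_closed subgroup.m_inv_closed subgroup.one_closed subgroup.mem_carrier)

lemma H_Gi [simp]: "h \<in> H \<Longrightarrow> h \<in> Gi"
  and D_Gi: "d \<in> D \<Longrightarrow> d \<in> Gi"
proof -
  show "h \<in> Gi" if "h \<in> H"
    using that D_one G.l_one[of h] unfolding DH[symmetric] set_mult_def by (metis (mono_tags, lifting) H_carrier UN_iff singletonI)
  show "d \<in> Gi" if "d \<in> D"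
    using that H_one G.r_one[of d] unfolding DH[symmetric] set_mult_def by (metis (mono_tags, lifting) D_carrier UN_iff singletonI)
qed

lemma D_conj [simp]: "d \<in> D \<Longrightarrow> h \<in> H \<Longrightarrow> inv\<^bsub>G\<^esub> h \<otimes>\<^bsub>G\<^esub> d \<otimes>\<^bsub>G\<^esub> h \<in> D"
  by (simp add: D_normal)

lemma lift_ex:
  assumes "d \<in> D" shows "\<exists>f. lift f d"
proof -
  have "\<phi> d \<in> carrier Bq"
    using assms phi_bij subgroup.subset[OF wr_D_sub] unfolding bij_betw_def by blast
  then show ?thesis using assms by (auto simp: lift_def carrier_Bq)
qed

lemma lift_mult: "lift f d \<Longrightarrow> lift g e \<Longrightarrow> lift (f \<otimes>\<^bsub>B\<^esub> g) (d \<otimes>\<^bsub>G\<^esub> e)"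
  by (simp add: lift_def phi_mult mult_Bq)

lemma lift_act: "lift f d \<Longrightarrow> h \<in> H \<Longrightarrow> lift (f \<star> h) (inv\<^bsub>G\<^esub> h \<otimes>\<^bsub>G\<^esub> d \<otimes>\<^bsub>G\<^esub> h)"
  by (simp add: lift_def phi_act coset_act_eq)

lemma phi_hom: "group_hom (G\<lparr>carrier := D\<rparr>) Bq \<phi>"
proof -
  have "\<phi> d \<in> carrier Bq" if "d \<in> D" for d
    using that phi_bij subgroup.subset[OF wr_D_sub] unfolding bij_betw_def by blast
  then show ?thesis
    by (auto simp: group_hom_def group_hom_axioms_def hom_def phi_mult intro: G.subgroup_imp_group[OF D_sub] Bq.group_axioms)
qed

lemma lift_one: "lift \<one>\<^bsub>B\<^esub> \<one>\<^bsub>G\<^esub>"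
  using group_hom.hom_one[OF phi_hom] N.subset
  by (simp add: lift_def wr_Bq_def B.coset_mult_one)

lemma lift_inv: "lift f d \<Longrightarrow> lift (inv\<^bsub>B\<^esub> f) (inv\<^bsub>G\<^esub> d)"
  using group_hom.hom_inv[OF phi_hom, of d] G.m_inv_consistent[OF D_sub, of d]
  by (auto simp add: lift_def inv_Bq)

lemma lift_gen: "f \<in> carrier B \<Longrightarrow> r \<in> R \<Longrightarrow> \<exists>d. lift (inv\<^bsub>B\<^esub> f \<otimes>\<^bsub>B\<^esub> (f \<star> r)) d"
proof -
  assume f: "f \<in> carrier B" and r: "r \<in> R"
  have "N #>\<^bsub>B\<^esub> (inv\<^bsub>B\<^esub> f \<otimes>\<^bsub>B\<^esub> (f \<star> r)) \<in> wr_D G H R M"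
    unfolding wr_D_gen by (intro generate.incl CollectI exI[of _ f] exI[of _ r]) (simp add: f r)
  then obtain d where "d \<in> D" "\<phi> d = N #>\<^bsub>B\<^esub> (inv\<^bsub>B\<^esub> f \<otimes>\<^bsub>B\<^esub> (f \<star> r))"
    using phi_bij unfolding bij_betw_def by (metis imageE)
  then show ?thesis using f r by (auto simp: lift_def)
qed

lemma lift_unique: "lift f d \<Longrightarrow> lift f e \<Longrightarrow> d = e"
  using phi_bij by (auto simp: lift_def bij_betw_def inj_on_def)

lemma lift_N: "lift f d \<Longrightarrow> n \<in> N \<Longrightarrow> lift (n \<otimes>\<^bsub>B\<^esub> f) d"
proof -
  assume *: "lift f d" "n \<in> N"
  then have n: "n \<in> carrier B" using N.subset by blast
  have "n \<otimes>\<^bsub>B\<^esub> f \<in> N #>\<^bsub>B\<^esub> f" using * by (auto simp: r_coset_def)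
  then show ?thesis
    using * n B.repr_independence[OF _ _ N.subgroup_axioms, of "n \<otimes>\<^bsub>B\<^esub> f" f] by (simp add: lift_def)
qed

lemma lift_zf_unique:
  assumes k: "lift (zf k) d" and l: "lift (zf l) e" and s: "int q dvd (\<Sum>x\<in>H. k x) - (\<Sum>x\<in>H. l x)"
  shows "d = e"
proof -
  have "lift (zf (\<lambda>x. k x - l x) \<otimes>\<^bsub>B\<^esub> zf l) e"
    using s by (intro lift_N l) (simp add: zf_in_N sum_subtractf)
  then show ?thesis using k lift_unique by (simp add: zf_mult)
qed

lemma lift_zf_one_iff:
  assumes k: "lift (zf k) d" shows "d = \<one>\<^bsub>G\<^esub> \<longleftrightarrow> int q dvd (\<Sum>x\<in>H. k x)"
proof
  assume "d = \<one>\<^bsub>G\<^esub>"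
  then have "N #>\<^bsub>B\<^esub> zf k = N" using k lift_one N.subset by (simp add: lift_def B.coset_mult_one)
  then have "zf k \<in> N" using B.rcos_self[OF zf_closed N.subgroup_axioms] by blast
  then show "int q dvd (\<Sum>x\<in>H. k x)" by (simp add: zf_in_N)
next
  assume "int q dvd (\<Sum>x\<in>H. k x)"
  then show "d = \<one>\<^bsub>G\<^esub>" using lift_zf_unique[OF k lift_one[unfolded zf_one]] by simp
qed

lemma lift_zf_pow: "lift (zf k) d \<Longrightarrow> lift (zf (\<lambda>x. int n * k x)) (d [^]\<^bsub>G\<^esub> n)"
proof (induction n)
  case 0
  then show ?case using lift_one by (simp add: zf_one)
next
  case (Suc n)
  then show ?case using lift_mult[OF Suc.IH Suc.prems]
    by (simp add: zf_mult algebra_simps)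
qed

text \<open>The exponent sum of a nontrivial \<open>w\<close> is invertible modulo the prime
  \<open>q\<close>, so a multiple of it reaches the sum of \<open>l\<close>. In particular
  \<open>zf l\<close> represents an element of \<open>D\<close>, which is not assumed.\<close>

lemma lift_zf_power_ex:
  assumes k: "lift (zf k) w" and w: "w \<noteq> \<one>\<^bsub>G\<^esub>"
  shows "\<exists>n::nat. lift (zf l) (w [^]\<^bsub>G\<^esub> n)"
proof -
  have "\<not> int q dvd (\<Sum>x\<in>H. k x)" using lift_zf_one_iff[OF k] w by blast
  then obtain n :: nat where n: "int q dvd int n * (\<Sum>x\<in>H. k x) - (\<Sum>x\<in>H. l x)"
    using exists_mult_cong_prime[OF prime_q] by blast
  have "zf (\<lambda>x. l x - int n * k x) \<in> N"
    using n by (simp add: zf_in_N sum_subtractf dvd_diff_commute flip: sum_distrib_left)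
  from lift_N[OF lift_zf_pow[OF k, of n] this] show ?thesis by (auto simp: zf_mult)
qed

lemma lift_zf_power:
  assumes "lift (zf k) w" "w \<noteq> \<one>\<^bsub>G\<^esub>" "lift (zf l) z"
  shows "\<exists>n::nat. z = w [^]\<^bsub>G\<^esub> n"
  using lift_zf_power_ex[OF assms(1,2)] lift_unique assms(3) by blast

lemma lift_zf_comm:
  assumes k: "lift (zf k) w" and d: "d \<in> D"
  shows "w \<otimes>\<^bsub>G\<^esub> d = d \<otimes>\<^bsub>G\<^esub> w"
proof -
  obtain f where f: "lift f d" using lift_ex[OF d] by blast
  show ?thesis
    using lift_mult[OF k f] lift_mult[OF f k] zf_comm[OF lift_B[OF f], of k] by (simp add: lift_unique)
qed

lemma lift_commutator:
  "lift f d \<Longrightarrow> lift g e \<Longrightarrow> lift (f \<otimes>\<^bsub>B\<^esub> g \<otimes>\<^bsub>B\<^esub> inv\<^bsub>B\<^esub> f \<otimes>\<^bsub>B\<^esub> inv\<^bsub>B\<^esub> g)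
     (d \<otimes>\<^bsub>G\<^esub> e \<otimes>\<^bsub>G\<^esub> inv\<^bsub>G\<^esub> d \<otimes>\<^bsub>G\<^esub> inv\<^bsub>G\<^esub> e)"
  by (intro lift_mult lift_inv)

text \<open>The part of \<open>D\<close> coming from the derived subgroup of \<open>B\<close>. That
  it is nontrivial and equals the derived subgroup of \<open>D\<close> is shown in
  \<open>C_nontrivial\<close> and \<open>derived_D\<close>.\<close>

definition C where "C = {d. \<exists>k. lift (zf k) d}"

lemma C_subgroup: "subgroup C G"
proof (rule G.subgroupI)
  show "C \<noteq> {}" unfolding C_def using lift_one[unfolded zf_one] by blast
  show "C \<subseteq> carrier G" by (auto simp: C_def dest: lift_D)
  show "inv\<^bsub>G\<^esub> d \<in> C" if "d \<in> C" for d using that lift_inv unfolding C_def by (fastforce simp: zf_inv)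
  show "d \<otimes>\<^bsub>G\<^esub> e \<in> C" if "d \<in> C" "e \<in> C" for d e using that lift_mult unfolding C_def by (fastforce simp: zf_mult)
qed

lemma commutator_in_C: "d \<in> D \<Longrightarrow> e \<in> D \<Longrightarrow> d \<otimes>\<^bsub>G\<^esub> e \<otimes>\<^bsub>G\<^esub> inv\<^bsub>G\<^esub> d \<otimes>\<^bsub>G\<^esub> inv\<^bsub>G\<^esub> e \<in> C"
proof -
  assume "d \<in> D" "e \<in> D"
  then obtain f g where fg: "lift f d" "lift g e" using lift_ex by blast
  then obtain k where "f \<otimes>\<^bsub>B\<^esub> g \<otimes>\<^bsub>B\<^esub> inv\<^bsub>B\<^esub> f \<otimes>\<^bsub>B\<^esub> inv\<^bsub>B\<^esub> g = zf k"
    using commutator_zf lift_B by blast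
  then show ?thesis using lift_commutator[OF fg] unfolding C_def by auto
qed

text \<open>\<open>D\<close> is isomorphic to a subgroup of a quotient of the \<open>q\<close>-group
  \<open>B\<close>.\<close>

lemma card_D: "\<exists>j. card D = q ^ j"
  and finite_D: "finite D"
proof -
  have fin: "finite (wr_D G H R M)"
    using finite_subset[OF subgroup.subset[OF wr_D_sub]] finite_B by (simp add: carrier_Bq)
  then show "finite D" using phi_bij bij_betw_finite by blast
  have "card (wr_D G H R M) dvd order Bq"
    by (rule dvdI[OF trans[OF Bq.lagrange[OF wr_D_sub, symmetric] mult.commute]])
  moreover have "card (rcosets\<^bsub>B\<^esub> N) dvd order B"
    by (rule dvdI[OF B.lagrange[OF N.subgroup_axioms, symmetric]])
  then have "order Bq dvd order B" by (simp add: wr_Bq_def order_def FactGroup_def)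
  ultimately have "card D dvd q ^ (m * card H)"
    using bij_betw_same_card[OF phi_bij] card_B dvd_trans by (simp add: order_def)
  then show "\<exists>j. card D = q ^ j" using divides_primepow_nat[OF prime_q] by blast
qed

lemma finite_Gi: "finite Gi"
  unfolding DH[symmetric] set_mult_def using finite_D finite_H by auto

end

section \<open>Exponent functions with vanishing coset sums\<close>

context wreath_step
begin

definition dl :: "'g \<Rightarrow> 'g \<Rightarrow> int" where "dl y x = (if x = y then 1 else 0)"

text \<open>Commutators with \<open>R\<close> produce such exponents (\<open>csum0_diff\<close>).
  The sums vanish as integers, not just modulo \<open>q\<close>, so that they may be divided by
  \<open>q\<close> in \<open>T_noncommuting\<close>.\<close>

definition csum0 :: "('g \<Rightarrow> int) \<Rightarrow> bool"
  where "csum0 n \<longleftrightarrow> (\<forall>x\<in>H. (\<Sum>r\<in>R. n (x \<otimes>\<^bsub>G\<^esub> r)) = 0)"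

lemma G_cancel:
  "x \<in> carrier G \<Longrightarrow> y \<in> carrier G \<Longrightarrow> x \<otimes>\<^bsub>G\<^esub> (inv\<^bsub>G\<^esub> x \<otimes>\<^bsub>G\<^esub> y) = y"
  "x \<in> carrier G \<Longrightarrow> y \<in> carrier G \<Longrightarrow> inv\<^bsub>G\<^esub> x \<otimes>\<^bsub>G\<^esub> (x \<otimes>\<^bsub>G\<^esub> y) = y"
  by (simp_all flip: G.m_assoc)

lemma R_closed: "x \<in> R \<Longrightarrow> y \<in> R \<Longrightarrow> x \<otimes>\<^bsub>G\<^esub> y \<in> R"
  using R_sub by (rule subgroup.m_closed)

lemma sum_dl: "y \<in> H \<Longrightarrow> (\<Sum>x\<in>H. dl y x * n x) = n y"
  by (simp add: dl_def finite_H sum.delta' if_distrib[of "\<lambda>u. u * _"] cong: if_cong)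

lemma dl_translate: "x \<in> H \<Longrightarrow> y \<in> H \<Longrightarrow> h \<in> H \<Longrightarrow> dl y (x \<otimes>\<^bsub>G\<^esub> inv\<^bsub>G\<^esub> h) = dl (y \<otimes>\<^bsub>G\<^esub> h) x"
  by (auto simp: dl_def G.m_assoc)

text \<open>Adding up the coset sums over all \<open>x\<close> counts every value
  \<open>card R\<close> times.\<close>

lemma csum0_sum:
  assumes "csum0 n" shows "(\<Sum>x\<in>H. n x) = 0"
proof -
  have "0 = (\<Sum>x\<in>H. \<Sum>r\<in>R. n (x \<otimes>\<^bsub>G\<^esub> r))" using assms by (simp add: csum0_def)
  also have "\<dots> = (\<Sum>r\<in>R. \<Sum>x\<in>H. n (x \<otimes>\<^bsub>G\<^esub> r))" by (rule sum.swap)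
  also have "\<dots> = int (card R) * (\<Sum>x\<in>H. n x)" by (simp add: sum_translate)
  finally show ?thesis using prime_card_R by (auto simp: prime_gt_0_nat)
qed

lemma csum0_diff:
  assumes "r \<in> R" shows "csum0 (\<lambda>x. n x - n (x \<otimes>\<^bsub>G\<^esub> inv\<^bsub>G\<^esub> r))"
proof -
  have "(\<Sum>s\<in>R. n (x \<otimes>\<^bsub>G\<^esub> s \<otimes>\<^bsub>G\<^esub> inv\<^bsub>G\<^esub> r)) = (\<Sum>s\<in>R. n (x \<otimes>\<^bsub>G\<^esub> s))" if "x \<in> H" for x
    by (rule sum.reindex_bij_witness[of _ "\<lambda>s. s \<otimes>\<^bsub>G\<^esub> r" "\<lambda>s. s \<otimes>\<^bsub>G\<^esub> inv\<^bsub>G\<^esub> r"])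
      (use that assms in \<open>auto simp: G.m_assoc R_closed\<close>)
  then show ?thesis by (simp add: csum0_def sum_subtractf)
qed

lemma csum0_translate:
  assumes "csum0 n" "h \<in> H" shows "csum0 (\<lambda>x. n (x \<otimes>\<^bsub>G\<^esub> h))"
  unfolding csum0_def
proof
  fix x assume x: "x \<in> H"
  have c: "h \<otimes>\<^bsub>G\<^esub> s \<otimes>\<^bsub>G\<^esub> inv\<^bsub>G\<^esub> h \<in> R" if "s \<in> R" for s
    using R_normal[of "inv\<^bsub>G\<^esub> h" s] that assms by simp
  \<comment> \<open>Since \<open>R\<close> is normal, \<open>x s h\<close> is \<open>x h\<close>
    times the conjugate \<open>h^-1 s h\<close>, so \<open>x R h\<close> is the coset
    \<open>x h R\<close>.\<close>
  have "(\<Sum>s\<in>R. n (x \<otimes>\<^bsub>G\<^esub> s \<otimes>\<^bsub>G\<^esub> h)) = (\<Sum>s\<in>R. n (x \<otimes>\<^bsub>G\<^esub> h \<otimes>\<^bsub>G\<^esub> s))"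
    by (rule sum.reindex_bij_witness[of _ "\<lambda>s. h \<otimes>\<^bsub>G\<^esub> s \<otimes>\<^bsub>G\<^esub> inv\<^bsub>G\<^esub> h" "\<lambda>s. inv\<^bsub>G\<^esub> h \<otimes>\<^bsub>G\<^esub> s \<otimes>\<^bsub>G\<^esub> h"])
      (use x assms c R_normal in \<open>auto simp: G.m_assoc G_cancel\<close>)
  then show "(\<Sum>s\<in>R. n (x \<otimes>\<^bsub>G\<^esub> s \<otimes>\<^bsub>G\<^esub> h)) = 0"
    using assms x by (simp add: csum0_def)
qed

text \<open>If \<open>n\<close> were constant modulo \<open>q\<close> on \<open>x R\<close>, the
  vanishing coset sum would be congruent to \<open>card R * n x\<close>; this is where the two
  primes have to differ.\<close>

lemma csum0_not_invariant:
  assumes n: "csum0 n" and x: "x \<in> H" "\<not> int q dvd n x"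
  shows "\<exists>r\<in>R. \<not> int q dvd n (x \<otimes>\<^bsub>G\<^esub> r) - n x"
proof (rule ccontr)
  assume "\<not> ?thesis"
  then have "int q dvd (\<Sum>r\<in>R. n (x \<otimes>\<^bsub>G\<^esub> r) - n x)" by (intro dvd_sum) auto
  then have "int q dvd int (card R) * n x"
    using n x by (simp add: sum_subtractf csum0_def)
  then have "int q dvd int (card R)"
    using x(2) prime_q prime_dvd_mult_iff[of "int q"] by simp
  then show False
    using prime_card_R prime_q card_R_ne primes_dvd_imp_eq by (metis of_nat_dvd_iff)
qed

lemma noncommuting:
  assumes t: "lift (F n k) t" and n: "csum0 n" and x: "x \<in> H" "\<not> int q dvd n x"
  shows "\<exists>d\<in>D. d \<otimes>\<^bsub>G\<^esub> t \<otimes>\<^bsub>G\<^esub> inv\<^bsub>G\<^esub> d \<otimes>\<^bsub>G\<^esub> inv\<^bsub>G\<^esub> t \<in> C - {\<one>\<^bsub>G\<^esub>}"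
proof -
  obtain r where r: "r \<in> R" "\<not> int q dvd n (x \<otimes>\<^bsub>G\<^esub> r) - n x"
    using csum0_not_invariant[OF n x] by blast
  \<comment> \<open>A difference of point masses at \<open>x r\<close> and \<open>x\<close>: as a
    commutator with \<open>r\<close> it is realised in \<open>D\<close>, and pairing it with
    \<open>n\<close> compares the values of \<open>n\<close> at these two points.\<close>
  let ?e = "\<lambda>y. dl x (y \<otimes>\<^bsub>G\<^esub> inv\<^bsub>G\<^esub> r) - dl x y"
  obtain d where d: "lift (bf ?e) d"
    using lift_gen[of "bf (dl x)" r] r by (auto simp: bf_diff)
  let ?w = "d \<otimes>\<^bsub>G\<^esub> t \<otimes>\<^bsub>G\<^esub> inv\<^bsub>G\<^esub> d \<otimes>\<^bsub>G\<^esub> inv\<^bsub>G\<^esub> t"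
  have w: "lift (zf (\<lambda>y. - ?e y * n y)) ?w"
    using lift_commutator[OF d t] by (simp add: commutator_bf_F)
  have "(\<Sum>y\<in>H. - ?e y * n y) = (\<Sum>y\<in>H. dl x y * n y) - (\<Sum>y\<in>H. dl (x \<otimes>\<^bsub>G\<^esub> r) y * n y)"
    using x r by (simp add: dl_translate sum_subtractf[symmetric] algebra_simps)
  also have "\<dots> = n x - n (x \<otimes>\<^bsub>G\<^esub> r)" using x r by (simp add: sum_dl)
  finally have "?w \<noteq> \<one>\<^bsub>G\<^esub>" using lift_zf_one_iff[OF w] r(2) by (simp add: dvd_diff_commute)
  moreover have "?w \<in> C" using w by (auto simp: C_def)
  ultimately show ?thesis using lift_D[OF d] by blast
qed

section \<open>Elements of \<open>D\<close> with prescribed commutators and conjugates\<close>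

abbreviation "nr r \<equiv> (\<lambda>x. dl \<one>\<^bsub>G\<^esub> x - dl \<one>\<^bsub>G\<^esub> (x \<otimes>\<^bsub>G\<^esub> inv\<^bsub>G\<^esub> r))"

text \<open>A negative point mass at the identity, commuted with \<open>r\<close>, gives the
  simplest exponents with vanishing coset sums: 1 at the identity and -1 at \<open>r\<close>, if
  \<open>r\<close> is not the identity.\<close>

lemma lift_nr:
  assumes "r \<in> R" shows "\<exists>d. lift (F (nr r) (\<lambda>_. 0)) d"
  using lift_gen[of "F (\<lambda>x. - dl \<one>\<^bsub>G\<^esub> x) (\<lambda>_. 0)" r] assms by (simp add: act_F F_inv F_mult)

lemma nr_simps: 
  assumes "r \<in> R" "r \<noteq> \<one>\<^bsub>G\<^esub>" "x \<in> H"
  shows "nr r \<one>\<^bsub>G\<^esub> = 1" "x \<noteq> \<one>\<^bsub>G\<^esub> \<Longrightarrow> nr r x = - dl r x"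
  using assms by (auto simp: dl_def) (metis G.inv_equality G.inv_inv H_carrier H_inv R_imp_H G.r_inv G.inv_solve_right' G.l_one G.one_closed)+

text \<open>The disjunction keeps the value \<open>1 + dl r h\<close> occurring in \<open>T_conj\<close> prime to \<open>q\<close>.\<close>
lemma exists_R:
  assumes "h \<in> H" shows "\<exists>r\<in>R. r \<noteq> \<one>\<^bsub>G\<^esub> \<and> (r \<noteq> h \<or> q \<noteq> 2)"
proof (cases "R \<subseteq> {\<one>\<^bsub>G\<^esub>, h}")
  \<comment> \<open>Here \<open>R\<close> has order 2, so \<open>q\<close> is not 2 and the second
    alternative holds.\<close>
  case True
  have "card R \<ge> 2" using prime_card_R by (rule prime_ge_2_nat)
  moreover have "card R \<le> card {\<one>\<^bsub>G\<^esub>, h}" using True by (intro card_mono) auto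
  moreover have "card {\<one>\<^bsub>G\<^esub>, h} \<le> 2" by (simp add: card_insert_if)
  ultimately have "card R = 2" by simp
  then have "q \<noteq> 2" "\<not> R \<subseteq> {\<one>\<^bsub>G\<^esub>}" using card_R_ne card_mono[of "{\<one>\<^bsub>G\<^esub>}" R] by auto
  then show ?thesis by blast
qed blast

text \<open>The exponent 1 of \<open>nr r\<close> at the identity makes \<open>noncommuting\<close>
  applicable. The conclusion records that \<open>w\<close> is a commutator because
  \<open>derived_D\<close> needs one.\<close>

lemma C_nontrivial: "\<exists>w\<in>C - {\<one>\<^bsub>G\<^esub>}. \<exists>d\<in>D. \<exists>t\<in>D. w = d \<otimes>\<^bsub>G\<^esub> t \<otimes>\<^bsub>G\<^esub> inv\<^bsub>G\<^esub> d \<otimes>\<^bsub>G\<^esub> inv\<^bsub>G\<^esub> t"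
proof -
  obtain r where r: "r \<in> R" "r \<noteq> \<one>\<^bsub>G\<^esub>" using exists_R[of "\<one>\<^bsub>G\<^esub>"] by auto
  obtain t where t: "lift (F (nr r) (\<lambda>_. 0)) t" using lift_nr r by blast
  have "\<not> int q dvd nr r \<one>\<^bsub>G\<^esub>"
    using nr_simps(1)[OF r, of "\<one>\<^bsub>G\<^esub>"] prime_q prime_gt_1_nat by auto
  then show ?thesis using noncommuting[OF t csum0_diff[OF r(1)], of "\<one>\<^bsub>G\<^esub>"] lift_D[OF t] by auto
qed

text \<open>One nontrivial element of \<open>C\<close> suffices, so \<open>D\<close> contains the
  image of the whole derived subgroup of \<open>B\<close>.\<close>

lemma lift_zf_ex: "\<exists>d. lift (zf k) d"
  using C_nontrivial lift_zf_power_ex unfolding C_def by blast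

text \<open>Multiplication by a central element adjusts \<open>k\<close> freely, which allows the
  normalisation \<open>cn n\<close>.\<close>

lemma lift_F_ex:
  assumes "lift (F n k) d" shows "\<exists>d. lift (F n l) d"
proof -
  obtain e where "lift (zf (\<lambda>x. l x - k x)) e" using lift_zf_ex by blast
  from lift_mult[OF this assms] show ?thesis by (auto simp: zf_eq_F F_mult)
qed

text \<open>Modulo \<open>N\<close> only the total of a central exponent matters; with
  \<open>n(1)\<close> placed at the identity that total is \<open>n(1)\<close>.\<close>

definition cn :: "('g \<Rightarrow> int) \<Rightarrow> 'g \<Rightarrow> int" where "cn n x = dl \<one>\<^bsub>G\<^esub> x * n \<one>\<^bsub>G\<^esub>"

lemma sum_cn: "(\<Sum>x\<in>H. cn n x) = n \<one>\<^bsub>G\<^esub>"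
  using sum_dl[of "\<one>\<^bsub>G\<^esub>" "\<lambda>_. n \<one>\<^bsub>G\<^esub>"] by (simp add: cn_def)

text \<open>The graph of a homomorphism \<open>n \<mapsto> n(1)\<close> into the centre of \<open>D\<close>. The group \<open>H\<close> permutes
  the graphs of this kind, and the one chosen here has trivial stabilizer.\<close>
definition T where "T = {d. \<exists>n. csum0 n \<and> lift (F n (cn n)) d}"

lemma T_subgroup: "subgroup T G"
proof (rule G.subgroupI)
  have "lift (F (\<lambda>_. 0) (cn (\<lambda>_. 0))) \<one>\<^bsub>G\<^esub>" using lift_one by (simp add: F_one cn_def[abs_def])
  moreover have "csum0 (\<lambda>_. 0)" by (simp add: csum0_def)
  ultimately show "T \<noteq> {}" unfolding T_def by blast
  show "T \<subseteq> carrier G" by (auto simp: T_def dest: lift_D)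
  show "inv\<^bsub>G\<^esub> d \<in> T" if "d \<in> T" for d
  proof -
    obtain n where n: "csum0 n" "lift (F n (cn n)) d" using \<open>d \<in> T\<close> by (auto simp: T_def)
    have "lift (F (\<lambda>x. - n x) (cn (\<lambda>x. - n x))) (inv\<^bsub>G\<^esub> d)"
      using lift_inv[OF n(2)] by (simp add: F_inv cn_def[abs_def])
    moreover have "csum0 (\<lambda>x. - n x)" using n(1) by (simp add: csum0_def sum_negf)
    ultimately show ?thesis unfolding T_def by blast
  qed
  show "d \<otimes>\<^bsub>G\<^esub> e \<in> T" if "d \<in> T" "e \<in> T" for d e
  proof -
    obtain n n' where n: "csum0 n" "lift (F n (cn n)) d" "csum0 n'" "lift (F n' (cn n')) e"
      using \<open>d \<in> T\<close> \<open>e \<in> T\<close> by (auto simp: T_def)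
    have "lift (F (\<lambda>x. n x + n' x) (cn (\<lambda>x. n x + n' x))) (d \<otimes>\<^bsub>G\<^esub> e)"
      using lift_mult[OF n(2,4)] by (simp add: F_mult cn_def[abs_def] ring_distribs)
    moreover have "csum0 (\<lambda>x. n x + n' x)" using n by (simp add: csum0_def sum.distrib)
    ultimately show ?thesis unfolding T_def by blast
  qed
qed

lemma T_D: "T \<subseteq> D"
  by (auto simp: T_def dest: lift_D)

text \<open>If some exponent is not divisible by \<open>q\<close>, this is
  \<open>noncommuting\<close>. Otherwise \<open>t\<close> is central, and the graph condition makes
  it trivial.\<close>

lemma T_noncommuting:
  assumes t: "t \<in> T" "t \<noteq> \<one>\<^bsub>G\<^esub>"
  shows "\<exists>d\<in>D. d \<otimes>\<^bsub>G\<^esub> t \<otimes>\<^bsub>G\<^esub> inv\<^bsub>G\<^esub> d \<otimes>\<^bsub>G\<^esub> inv\<^bsub>G\<^esub> t \<in> C - {\<one>\<^bsub>G\<^esub>}"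
proof -
  obtain n where n: "csum0 n" "lift (F n (cn n)) t" using t by (auto simp: T_def)
  show ?thesis
  proof (cases "\<forall>x\<in>H. int q dvd n x")
    case True
    \<comment> \<open>The power \<open>a^q\<close> is central but perhaps nontrivial. It contributes
      \<open>c\<close> times the sum of all \<open>n x div q\<close>, which is zero, so the total
      exponent is \<open>n(1)\<close>, a multiple of \<open>q\<close>.\<close>
    obtain c :: int where c: "a [^] int q = zt [^] c"
      using a_pow_center_iff[of "int q"] center_eq by auto
    have "F n (cn n) = zf (\<lambda>x. c * (n x div int q) + cn n x)"
      unfolding F_def zf_def
    proof (rule restrict_ext)
      fix x assume "x \<in> H"
      then have "a [^] n x = (a [^] int q) [^] (n x div int q)" using True by (simp add: int_pow_pow)
      then have "a [^] n x = zt [^] (c * (n x div int q))" using c by (simp add: int_pow_pow)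
      then show "a [^] n x \<otimes> zt [^] cn n x = zt [^] (c * (n x div int q) + cn n x)"
        by (simp add: int_pow_mult)
    qed
    with n have l: "lift (zf (\<lambda>x. c * (n x div int q) + cn n x)) t" by simp
    have q0: "int q \<noteq> 0" using prime_q by auto
    have "int q * (\<Sum>x\<in>H. n x div int q) = (\<Sum>x\<in>H. n x)"
      unfolding sum_distrib_left by (rule sum.cong) (use True in auto)
    then have "(\<Sum>x\<in>H. n x div int q) = 0" using csum0_sum[OF n(1)] q0 by simp
    then have "(\<Sum>x\<in>H. c * (n x div int q) + cn n x) = n \<one>\<^bsub>G\<^esub>"
      by (simp add: sum.distrib sum_cn flip: sum_distrib_left)
    then have False using lift_zf_one_iff[OF l] t True by simp
    then show ?thesis ..
  next
    case False
    then show ?thesis using noncommuting[OF n(2) n(1)] by blast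
  qed
qed

text \<open>Two elements with the same \<open>a\<close>-exponents are compared: the conjugate of
  \<open>t\<close>, with central total \<open>n(1)\<close>, and the member of \<open>T\<close> over
  the translated exponents, with total \<open>n(h)\<close>. Their quotient is central with total
  \<open>n(1) - n(h)\<close>, which is 1 or 2.\<close>

lemma T_conj:
  assumes h: "h \<in> H" "h \<noteq> \<one>\<^bsub>G\<^esub>"
  shows "\<exists>t0\<in>T. \<exists>t\<in>T. t0 \<otimes>\<^bsub>G\<^esub> (h \<otimes>\<^bsub>G\<^esub> t \<otimes>\<^bsub>G\<^esub> inv\<^bsub>G\<^esub> h) \<in> C - {\<one>\<^bsub>G\<^esub>}"
proof -
  obtain r where r: "r \<in> R" "r \<noteq> \<one>\<^bsub>G\<^esub>" "r \<noteq> h \<or> q \<noteq> 2" using exists_R h by blast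
  define n where "n = nr r"
  have n1: "n \<one>\<^bsub>G\<^esub> = 1" and nh: "n h = - dl r h"
    unfolding n_def using nr_simps[OF r(1,2)] h by auto
  have cs: "csum0 n" unfolding n_def using r by (intro csum0_diff)
  obtain t where t: "lift (F n (cn n)) t"
    using lift_nr[OF r(1)] lift_F_ex unfolding n_def by blast
  let ?n' = "\<lambda>x. n (x \<otimes>\<^bsub>G\<^esub> h)"
  have ht: "lift (F ?n' (\<lambda>x. cn n (x \<otimes>\<^bsub>G\<^esub> h))) (h \<otimes>\<^bsub>G\<^esub> t \<otimes>\<^bsub>G\<^esub> inv\<^bsub>G\<^esub> h)"
    using lift_act[OF t, of "inv\<^bsub>G\<^esub> h"] h by (simp add: act_F)
  have cs': "csum0 ?n'" using csum0_translate[OF cs h(1)] .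
  obtain t1 where t1: "lift (F ?n' (cn ?n')) t1" using lift_F_ex[OF ht] by blast
  have "t \<in> T" using t cs by (auto simp: T_def)
  moreover have "inv\<^bsub>G\<^esub> t1 \<in> T"
    using t1 cs' subgroup.m_inv_closed[OF T_subgroup] unfolding T_def by blast
  moreover have w: "lift (zf (\<lambda>x. cn n (x \<otimes>\<^bsub>G\<^esub> h) - cn ?n' x)) (inv\<^bsub>G\<^esub> t1 \<otimes>\<^bsub>G\<^esub> (h \<otimes>\<^bsub>G\<^esub> t \<otimes>\<^bsub>G\<^esub> inv\<^bsub>G\<^esub> h))"
    using lift_mult[OF lift_inv[OF t1] ht] by (simp add: F_inv F_mult zf_eq_F)
  moreover have "(\<Sum>x\<in>H. cn n (x \<otimes>\<^bsub>G\<^esub> h) - cn ?n' x) = 1 + dl r h"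
    using h by (simp add: sum_subtractf sum_translate[of h "cn n"] sum_cn n1 nh)
  moreover have "\<not> int q dvd 1 + dl r h"
  proof
    assume "int q dvd 1 + dl r h"
    moreover have "q \<ge> 2" using prime_q by (rule prime_ge_2_nat)
    ultimately show False using r(3) zdvd_imp_le[of "int q" "1 + dl r h"] by (auto simp: dl_def split: if_splits)
  qed
  ultimately have "inv\<^bsub>G\<^esub> t1 \<otimes>\<^bsub>G\<^esub> (h \<otimes>\<^bsub>G\<^esub> t \<otimes>\<^bsub>G\<^esub> inv\<^bsub>G\<^esub> h) \<in> C - {\<one>\<^bsub>G\<^esub>}" "t \<in> T" "inv\<^bsub>G\<^esub> t1 \<in> T"
    using lift_zf_one_iff[OF w] by (auto simp: C_def)
  then show ?thesis by blast
qed

text \<open>Commutators lie in \<open>C\<close>, and every element of \<open>C\<close> is a power of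
  the nontrivial commutator from \<open>C_nontrivial\<close>. Its \<open>q\<close>-th power has
  exponent sum divisible by \<open>q\<close>, so its order is \<open>q\<close>.\<close>

lemma derived_D: "derived G D = C"
  and card_C: "card C = q"
proof -
  obtain w d t where w: "w \<in> C" "w \<noteq> \<one>\<^bsub>G\<^esub>" "d \<in> D" "t \<in> D" "w = d \<otimes>\<^bsub>G\<^esub> t \<otimes>\<^bsub>G\<^esub> inv\<^bsub>G\<^esub> d \<otimes>\<^bsub>G\<^esub> inv\<^bsub>G\<^esub> t"
    using C_nontrivial by blast
  then obtain k where k: "lift (zf k) w" by (auto simp: C_def)
  have wc: "w \<in> carrier G" using w by simp
  have "derived G D \<subseteq> C"
    unfolding derived_def by (rule G.generate_subgroup_incl[OF _ C_subgroup]) (use commutator_in_C in auto)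
  moreover have wd: "w \<in> derived G D"
    unfolding derived_def w(5) using w(3,4) by (intro generate.incl) blast
  have "subgroup (derived G D) G"
    using D_sub by (intro G.derived_is_subgroup) (auto dest: subgroup.subset)
  then have pw: "w [^]\<^bsub>G\<^esub> (n::nat) \<in> derived G D" for n
    using wd G.subgroup_int_pow_closed[of _ w "int n"] by (simp add: int_pow_int)
  moreover have C_pow: "\<exists>n::nat. c = w [^]\<^bsub>G\<^esub> n" if "c \<in> C" for c
    using that lift_zf_power[OF k w(2)] by (auto simp: C_def)
  ultimately show "derived G D = C" by blast
  have "w [^]\<^bsub>G\<^esub> q = \<one>\<^bsub>G\<^esub>"
    using lift_zf_one_iff[OF lift_zf_pow[OF k, of q]] by (simp flip: sum_distrib_left)
  then have "G.ord w dvd q" using G.pow_eq_id[OF wc] by blast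
  moreover have "G.ord w \<noteq> 1" using G.ord_eq_1[OF wc] w(2) by simp
  ultimately have "G.ord w = q" using prime_q by (auto simp: prime_nat_iff)
  moreover have "C = generate G {w}"
  proof
    show "generate G {w} \<subseteq> C" using w(1) by (intro G.generate_subgroup_incl C_subgroup) auto
    show "C \<subseteq> generate G {w}"
      using C_pow unfolding G.generate_pow[OF wc] by (force simp flip: int_pow_int)
  qed
  ultimately show "card C = q" using G.generate_pow_card[OF wc] by simp
qed

text \<open>\<open>D\<close> centralises \<open>C\<close>, so conjugation by \<open>g = d h\<close>
  reduces to conjugation by \<open>h\<close>, which only translates exponents.\<close>

lemma C_normal:
  assumes "g \<in> Gi" "c \<in> C" shows "inv\<^bsub>G\<^esub> g \<otimes>\<^bsub>G\<^esub> c \<otimes>\<^bsub>G\<^esub> g \<in> C"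
proof -
  obtain d h where g: "d \<in> D" "h \<in> H" "g = d \<otimes>\<^bsub>G\<^esub> h"
    using assms unfolding DH[symmetric] set_mult_def by blast
  obtain k where k: "lift (zf k) c" using assms by (auto simp: C_def)
  have c: "c \<in> D" by (rule lift_D[OF k])
  have "inv\<^bsub>G\<^esub> d \<otimes>\<^bsub>G\<^esub> c \<otimes>\<^bsub>G\<^esub> d = c"
    using lift_zf_comm[OF k g(1)] g(1) c by (simp add: G.m_assoc) (simp flip: G.m_assoc)
  then have "inv\<^bsub>G\<^esub> g \<otimes>\<^bsub>G\<^esub> c \<otimes>\<^bsub>G\<^esub> g = inv\<^bsub>G\<^esub> h \<otimes>\<^bsub>G\<^esub> c \<otimes>\<^bsub>G\<^esub> h"
    using g c by (simp add: G.inv_mult_group) (metis D_carrier D_inv D_mult G.m_assoc G.m_closed H_carrier H_inv)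
  moreover have "inv\<^bsub>G\<^esub> h \<otimes>\<^bsub>G\<^esub> c \<otimes>\<^bsub>G\<^esub> h \<in> C"
    using lift_act[OF k g(2)] g(2) by (auto simp: act_zf C_def)
  ultimately show ?thesis by simp
qed

text \<open>If \<open>d\<close> is a lift of \<open>f\<inverse> f\<^sup>r\<close>, then \<open>d\<close> and its conjugates by powers of \<open>r\<close> agree modulo \<open>K\<close>,
  and their telescoping product gives \<open>d ^ card R \<in> K\<close>.\<close>
lemma D_subset_normal:
  assumes K: "K \<lhd> G" and RK: "R \<subseteq> K"
  shows "D \<subseteq> K"
proof -
  interpret K: normal K G by fact
  have gen: "d \<in> K" if f: "f \<in> carrier B" and r: "r \<in> R" and d: "lift (inv\<^bsub>B\<^esub> f \<otimes>\<^bsub>B\<^esub> (f \<star> r)) d" for f r d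
  proof -
    have dG: "d \<in> carrier G" and rG: "r \<in> carrier G" using lift_D[OF d] r by auto
    have rk: "r [^]\<^bsub>G\<^esub> (k::nat) \<in> R" for k by (induction k) (use r R_closed in auto)
    have step: "\<exists>e. lift (inv\<^bsub>B\<^esub> f \<otimes>\<^bsub>B\<^esub> (f \<star> (r [^]\<^bsub>G\<^esub> k))) e \<and> K #>\<^bsub>G\<^esub> e = K #>\<^bsub>G\<^esub> (d [^]\<^bsub>G\<^esub> k)" for k :: nat
    proof (induction k)
      case 0
      then show ?case using f lift_one by (auto simp: act_one)
    next
      case (Suc k)
      then obtain e where e: "lift (inv\<^bsub>B\<^esub> f \<otimes>\<^bsub>B\<^esub> (f \<star> (r [^]\<^bsub>G\<^esub> k))) e" "K #>\<^bsub>G\<^esub> e = K #>\<^bsub>G\<^esub> (d [^]\<^bsub>G\<^esub> k)" by blast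
      let ?s = "r [^]\<^bsub>G\<^esub> k"
      let ?d = "inv\<^bsub>G\<^esub> ?s \<otimes>\<^bsub>G\<^esub> d \<otimes>\<^bsub>G\<^esub> ?s"
      have sH: "?s \<in> H" "?s \<in> K" using rk[of k] RK by auto
      have rs: "r \<otimes>\<^bsub>G\<^esub> ?s = r [^]\<^bsub>G\<^esub> Suc k" by (rule G.nat_pow_Suc2[OF rG, symmetric])
      \<comment> \<open>Conjugation by \<open>r^k\<close> turns the lift of \<open>f^-1 f^r\<close>
        into the next telescoping factor.\<close>
      have "lift (inv\<^bsub>B\<^esub> (f \<star> ?s) \<otimes>\<^bsub>B\<^esub> (f \<star> (r [^]\<^bsub>G\<^esub> Suc k))) ?d"
        using lift_act[OF d sH(1)] f r sH by (simp add: act_mult act_act rs act_inv del: nat_pow_Suc)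
      from lift_mult[OF e(1) this]
      have "lift (inv\<^bsub>B\<^esub> f \<otimes>\<^bsub>B\<^esub> (f \<star> (r [^]\<^bsub>G\<^esub> Suc k))) (e \<otimes>\<^bsub>G\<^esub> ?d)"
        using f r sH rk[of "Suc k"] by (simp add: B.m_assoc del: nat_pow_Suc) (simp flip: B.m_assoc)
      moreover have "K #>\<^bsub>G\<^esub> (e \<otimes>\<^bsub>G\<^esub> ?d) = K #>\<^bsub>G\<^esub> (d [^]\<^bsub>G\<^esub> Suc k)"
      proof -
        have eG: "e \<in> carrier G" using lift_D[OF e(1)] by simp
        \<comment> \<open>Since \<open>r^k\<close> lies in \<open>K\<close>, conjugation by it is
          invisible modulo \<open>K\<close>.\<close>
        have "K #>\<^bsub>G\<^esub> ?d = (K #>\<^bsub>G\<^esub> inv\<^bsub>G\<^esub> ?s) <#>\<^bsub>G\<^esub> (K #>\<^bsub>G\<^esub> d) <#>\<^bsub>G\<^esub> (K #>\<^bsub>G\<^esub> ?s)"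
          using dG sH by (simp add: K.rcos_sum)
        also have "\<dots> = (K #>\<^bsub>G\<^esub> \<one>\<^bsub>G\<^esub>) <#>\<^bsub>G\<^esub> (K #>\<^bsub>G\<^esub> d) <#>\<^bsub>G\<^esub> (K #>\<^bsub>G\<^esub> \<one>\<^bsub>G\<^esub>)"
          using sH K.rcos_const K.subset by (simp add: G.coset_mult_one)
        also have "\<dots> = K #>\<^bsub>G\<^esub> d" using dG by (simp add: K.rcos_sum)
        finally have "K #>\<^bsub>G\<^esub> ?d = K #>\<^bsub>G\<^esub> d" .
        then show ?thesis
          using K.rcos_sum[of e ?d] K.rcos_sum[of "d [^]\<^bsub>G\<^esub> k" d] eG dG sH e(2) by simp
      qed
      ultimately show ?case by blast
    qed
    have "r [^]\<^bsub>G\<^esub> card R = \<one>\<^bsub>G\<^esub>"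
    proof -
      interpret RG: group "G\<lparr>carrier := R\<rparr>" by (rule G.subgroup_imp_group[OF R_sub])
      have "r [^]\<^bsub>G\<lparr>carrier := R\<rparr>\<^esub> card R = \<one>\<^bsub>G\<^esub>"
        using RG.pow_order_eq_1[of r] r by (simp add: order_def)
      then show ?thesis by (simp add: G.nat_pow_consistent[symmetric])
    qed
    \<comment> \<open>At \<open>k = card R\<close> the telescoped product is \<open>f^-1 f\<close>,
      so \<open>e\<close> is trivial.\<close>
    with step[of "card R"] f obtain e where e: "lift \<one>\<^bsub>B\<^esub> e" "K #>\<^bsub>G\<^esub> e = K #>\<^bsub>G\<^esub> (d [^]\<^bsub>G\<^esub> card R)"
      by (auto simp: act_one)
    have "e = \<one>\<^bsub>G\<^esub>" using e(1) lift_one lift_unique by blast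
    then have 1: "d [^]\<^bsub>G\<^esub> card R \<in> K"
      using e(2) G.rcos_self[of "d [^]\<^bsub>G\<^esub> card R" K] dG K.subgroup_axioms K.subset by (simp add: G.coset_mult_one)
    have 2: "d [^]\<^bsub>G\<^esub> card D = \<one>\<^bsub>G\<^esub>"
    proof -
      interpret DG: group "G\<lparr>carrier := D\<rparr>" by (rule G.subgroup_imp_group[OF D_sub])
      have "d [^]\<^bsub>G\<lparr>carrier := D\<rparr>\<^esub> card D = \<one>\<^bsub>G\<^esub>"
        using DG.pow_order_eq_1[of d] lift_D[OF d] by (simp add: order_def)
      then show ?thesis by (simp add: G.nat_pow_consistent[symmetric])
    qed
    obtain j where "card D = q ^ j" using card_D by blast
    \<comment> \<open>The order of \<open>d\<close> divides a power of \<open>q\<close>, and its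
      order modulo \<open>K\<close> divides the other prime; a Bezout relation puts \<open>d\<close>
      into \<open>K\<close>.\<close>
    then have "coprime (int (card R)) (int (card D))"
      using primes_coprime[OF prime_card_R prime_q card_R_ne] by simp
    then obtain u v where uv: "u * int (card R) + v * int (card D) = 1"
      using bezout_int by (metis coprime_imp_gcd_eq_1)
    have "d = d [^]\<^bsub>G\<^esub> (int (card R) * u + int (card D) * v)" using dG uv by (simp add: mult.commute)
    also have "\<dots> = (d [^]\<^bsub>G\<^esub> int (card R)) [^]\<^bsub>G\<^esub> u \<otimes>\<^bsub>G\<^esub> (d [^]\<^bsub>G\<^esub> int (card D)) [^]\<^bsub>G\<^esub> v"
      using dG by (simp add: G.int_pow_mult G.int_pow_pow)
    also have "\<dots> = (d [^]\<^bsub>G\<^esub> card R) [^]\<^bsub>G\<^esub> u"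
      using dG 2 by (simp add: int_pow_int)
    also have "\<dots> \<in> K" using 1 G.subgroup_int_pow_closed[OF K.subgroup_axioms] by blast
    finally show ?thesis .
  qed
  \<comment> \<open>The induction runs over the generated subgroup \<open>wr_D\<close>, so the claim
    is phrased for preimages under \<open>\<phi>\<close>.\<close>
  have "\<forall>d\<in>D. \<phi> d = y \<longrightarrow> d \<in> K" if "y \<in> wr_D G H R M" for y
    using that unfolding wr_D_gen
  proof (induction rule: generate.induct)
    case one
    show ?case
    proof (intro ballI impI)
      fix d assume "d \<in> D" "\<phi> d = \<one>\<^bsub>Bq\<^esub>"
      then have "lift \<one>\<^bsub>B\<^esub> d" using N.subset by (simp add: lift_def wr_Bq_def B.coset_mult_one)
      then show "d \<in> K" using lift_unique lift_one K.one_closed by blast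
    qed
  next
    case (incl y)
    then show ?case using gen by (auto simp: lift_def)
  next
    case (inv y)
    show ?case
    proof (intro ballI impI)
      fix d assume d: "d \<in> D" "\<phi> d = inv\<^bsub>Bq\<^esub> y"
      obtain f r where f: "f \<in> carrier B" "r \<in> R" "y = N #>\<^bsub>B\<^esub> (inv\<^bsub>B\<^esub> f \<otimes>\<^bsub>B\<^esub> (f \<star> r))"
        using inv by blast
      then have "lift (inv\<^bsub>B\<^esub> (inv\<^bsub>B\<^esub> f \<otimes>\<^bsub>B\<^esub> (f \<star> r))) d"
        using d by (simp add: lift_def inv_Bq)
      from lift_inv[OF this] have "lift (inv\<^bsub>B\<^esub> f \<otimes>\<^bsub>B\<^esub> (f \<star> r)) (inv\<^bsub>G\<^esub> d)" using f by simp
      then have "inv\<^bsub>G\<^esub> d \<in> K" using gen f by blast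
      then show "d \<in> K" using K.m_inv_closed[of "inv\<^bsub>G\<^esub> d"] d by simp
    qed
  next
    case (eng y z)
    show ?case
    proof (intro ballI impI)
      fix d assume d: "d \<in> D" "\<phi> d = y \<otimes>\<^bsub>Bq\<^esub> z"
      have yz: "y \<in> \<phi> ` D" "z \<in> \<phi> ` D"
        using eng phi_bij unfolding bij_betw_def wr_D_gen by auto
      then obtain d1 d2 where d12: "d1 \<in> D" "d2 \<in> D" "y = \<phi> d1" "z = \<phi> d2" by blast
      then have "d = d1 \<otimes>\<^bsub>G\<^esub> d2"
        using d phi_bij by (auto simp: bij_betw_def inj_on_def phi_mult[symmetric])
      then show "d \<in> K" using d12 eng.IH by blast
    qed
  qed
  then show ?thesis using phi_bij unfolding bij_betw_def by blast
qed

end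

section \<open>Ideals of group algebras\<close>

text \<open>The group element \<open>x\<close> viewed as a basis element of the group
  algebra.\<close>

definition pt :: "'g \<Rightarrow> 'g \<Rightarrow> 'k::field" where "pt x = (\<lambda>y. if y = x then 1 else 0)"

lemma (in group) subgroup_sum_translate:
  assumes T: "subgroup T G" and t: "t \<in> T"
  shows "(\<Sum>x\<in>T. \<psi> (x \<otimes> t)) = (\<Sum>x\<in>T. \<psi> x)" and "(\<Sum>x\<in>T. \<psi> (t \<otimes> x)) = (\<Sum>x\<in>T. \<psi> x)"
proof -
  have T1: "x \<in> carrier G" "inv x \<in> T" if "x \<in> T" for x 
    using that subgroup.mem_carrier[OF T] subgroup.m_inv_closed[OF T] by auto
  have T2: "x \<otimes> y \<in> T" if "x \<in> T" "y \<in> T" for x y using that subgroup.m_closed[OF T] by auto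
  have 1: "inv t \<otimes> (t \<otimes> x) = x" "t \<otimes> (inv t \<otimes> x) = x" if "x \<in> T" for x
    using that t T1 by (simp_all flip: m_assoc)
  show "(\<Sum>x\<in>T. \<psi> (x \<otimes> t)) = (\<Sum>x\<in>T. \<psi> x)"
    by (rule sum.reindex_bij_witness[of _ "\<lambda>x. x \<otimes> inv t" "\<lambda>x. x \<otimes> t"]) (use t T1 T2 in \<open>auto simp: m_assoc\<close>)
  show "(\<Sum>x\<in>T. \<psi> (t \<otimes> x)) = (\<Sum>x\<in>T. \<psi> x)"
    by (rule sum.reindex_bij_witness[of _ "\<lambda>x. inv t \<otimes> x" "\<lambda>x. t \<otimes> x"]) (use t T1 T2 1 in auto)
qed

locale group_algebra_ideal = group G for G :: "('g, 'd) monoid_scheme" (structure) +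
  fixes I :: "('g \<Rightarrow> 'k::field) set"
  assumes ideal: "two_sided_ideal G I"
begin

text \<open>The product \<open>a f b\<close> in the group algebra, with the group elements
  \<open>a\<close> and \<open>b\<close> as factors; \<open>ideal_tr\<close> verifies this for
  \<open>f\<close> in the ideal.\<close>

definition tr :: "'g \<Rightarrow> 'g \<Rightarrow> ('g \<Rightarrow> 'k) \<Rightarrow> 'g \<Rightarrow> 'k"
  where "tr a b f = (\<lambda>x. if x \<in> carrier G then f (inv a \<otimes> x \<otimes> inv b) else 0)"

lemma pt_mem [simp]: "a \<in> carrier G \<Longrightarrow> pt a \<in> group_algebra G"
  by (auto simp: group_algebra_def pt_def)

lemma ideal_sub: "f \<in> I \<Longrightarrow> f \<in> group_algebra G"
  and ideal_zero: "(\<lambda>_. 0) \<in> I"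
  and ideal_add: "f \<in> I \<Longrightarrow> g \<in> I \<Longrightarrow> (\<lambda>x. f x + g x) \<in> I"
  and ideal_scale: "f \<in> I \<Longrightarrow> (\<lambda>x. c * f x) \<in> I"
  using ideal by (auto simp: two_sided_ideal_def)

lemma ideal_diff: "f \<in> I \<Longrightarrow> g \<in> I \<Longrightarrow> (\<lambda>x. f x - g x) \<in> I"
  using ideal_add[of f "\<lambda>x. - 1 * g x"] ideal_scale[of g "- 1"] by simp

lemma ideal_sum: "(\<And>i. i \<in> S \<Longrightarrow> \<psi> i \<in> I) \<Longrightarrow> (\<lambda>x. \<Sum>i\<in>S. \<psi> i x) \<in> I"
  by (induction S rule: infinite_finite_induct) (auto simp: ideal_zero ideal_add)

lemma ideal_outside: "f \<in> I \<Longrightarrow> x \<notin> carrier G \<Longrightarrow> f x = 0"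
  using ideal_sub by (auto simp: group_algebra_def)

lemma ideal_tr:
  assumes f: "f \<in> I" and a: "a \<in> carrier G" and b: "b \<in> carrier G"
  shows "tr a b f \<in> I"
proof -
  have 1: "ga_mult G f (pt b) \<in> I" using ideal f b by (simp add: two_sided_ideal_def)
  then have "ga_mult G (pt a) (ga_mult G f (pt b)) \<in> I" using ideal a by (simp add: two_sided_ideal_def)
  moreover have "ga_mult G (pt a) (ga_mult G f (pt b)) = tr a b f"
  proof
    fix x
    have fb: "ga_mult G f (pt b) y = f (y \<otimes> inv b)" if y: "y \<in> carrier G" for y
    proof -
      have fin: "finite {z. f z \<noteq> 0}" and sup: "{z. f z \<noteq> 0} \<subseteq> carrier G"
        using ideal_sub[OF f] by (auto simp: group_algebra_def)
      have "inv z \<otimes> y = b \<longleftrightarrow> z = y \<otimes> inv b" if "f z \<noteq> 0" for z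
      proof -
        have z: "z \<in> carrier G" using that sup by blast
        have "inv z \<otimes> y = b \<longleftrightarrow> y = z \<otimes> b" using z y b inv_solve_left' by blast
        also have "\<dots> \<longleftrightarrow> z = y \<otimes> inv b" using z y b inv_solve_right by blast
        finally show ?thesis .
      qed
      then have "ga_mult G f (pt b) y = (\<Sum>z\<in>{z. f z \<noteq> 0}. if z = y \<otimes> inv b then f z else 0)"
        using y unfolding ga_mult_def by (auto simp: pt_def intro!: sum.cong)
      also have "\<dots> = f (y \<otimes> inv b)" using fin by (simp add: sum.delta)
      finally show ?thesis .
    qed
    have "{y. pt a y \<noteq> (0::'k)} = {a}" by (auto simp: pt_def)
    then show "ga_mult G (pt a) (ga_mult G f (pt b)) x = tr a b f x"
      using a by (simp add: ga_mult_def[of G "pt a"] tr_def fb) (simp add: pt_def)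
  qed
  ultimately show ?thesis by simp
qed

lemma tr_eq_iff:
  "a \<in> carrier G \<Longrightarrow> b \<in> carrier G \<Longrightarrow> h \<in> carrier G \<Longrightarrow> x \<in> carrier G
    \<Longrightarrow> inv a \<otimes> x \<otimes> inv b = h \<longleftrightarrow> x = a \<otimes> h \<otimes> b"
  by (metis inv_closed inv_solve_left' inv_solve_right' m_assoc m_closed)

text \<open>The kernel of the map from \<open>G\<close> to the units of the quotient of the group
  algebra by \<open>I\<close>.\<close>

definition K where "K = {x \<in> carrier G. (\<lambda>y. pt \<one> y - pt x y) \<in> I}"

lemma tr_pt_diff:
  assumes "a \<in> carrier G" "b \<in> carrier G" "x \<in> carrier G" "y \<in> carrier G"
  shows "tr a b (\<lambda>z. pt x z - pt y z) = (\<lambda>z. pt (a \<otimes> x \<otimes> b) z - pt (a \<otimes> y \<otimes> b) z)"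
  using assms by (auto simp: tr_def pt_def fun_eq_iff tr_eq_iff)

text \<open>Right multiplication by a group element preserves the ideal and can be undone, so
  congruence of group elements modulo \<open>I\<close> is congruence modulo
  \<open>K\<close>.\<close>

lemma pt_diff_iff:
  assumes x: "x \<in> carrier G" and g: "g \<in> carrier G"
  shows "(\<lambda>z. pt g z - pt x z) \<in> I \<longleftrightarrow> x \<otimes> inv g \<in> K"
proof
  assume "(\<lambda>z. pt g z - pt x z) \<in> I"
  from ideal_tr[OF this, of \<one> "inv g"] show "x \<otimes> inv g \<in> K"
    using x g by (simp add: K_def tr_pt_diff)
next
  assume "x \<otimes> inv g \<in> K"
  then have "(\<lambda>z. pt \<one> z - pt (x \<otimes> inv g) z) \<in> I" by (simp add: K_def)
  from ideal_tr[OF this, of \<one> g] show "(\<lambda>z. pt g z - pt x z) \<in> I"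
    using x g by (simp add: tr_pt_diff m_assoc)
qed

lemma K_normal: "K \<lhd> G"
proof -
  have sub: "subgroup K G"
  proof (rule subgroupI)
    show "K \<subseteq> carrier G" by (auto simp: K_def)
    have "\<one> \<in> K" using ideal_zero by (simp add: K_def)
    then show "K \<noteq> {}" by blast
    show "inv x \<in> K" if "x \<in> K" for x
    proof -
      have x: "x \<in> carrier G" "(\<lambda>y. pt \<one> y - pt x y) \<in> I" using that by (auto simp: K_def)
      have "(\<lambda>y. pt (inv x) y - pt \<one> y) \<in> I"
        using ideal_tr[OF x(2), of "inv x" \<one>] x(1) by (simp add: tr_pt_diff)
      from ideal_scale[OF this, of "-1"] show ?thesis using x(1) by (simp add: K_def)
    qed
    show "x \<otimes> y \<in> K" if "x \<in> K" "y \<in> K" for x y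
    proof -
      have x: "x \<in> carrier G" "(\<lambda>z. pt \<one> z - pt x z) \<in> I" and y: "y \<in> carrier G" "(\<lambda>z. pt \<one> z - pt y z) \<in> I"
        using that by (auto simp: K_def)
      have "(\<lambda>z. pt x z - pt (x \<otimes> y) z) \<in> I"
        using ideal_tr[OF y(2), of x \<one>] x y by (simp add: tr_pt_diff)
      from ideal_add[OF x(2) this] show ?thesis using x y by (simp add: K_def)
    qed
  qed
  moreover have "g \<otimes> x \<otimes> inv g \<in> K" if "g \<in> carrier G" "x \<in> K" for g x
  proof -
    have x: "x \<in> carrier G" "(\<lambda>z. pt \<one> z - pt x z) \<in> I" using that by (auto simp: K_def)
    show ?thesis using ideal_tr[OF x(2), of g "inv g"] x(1) that(1) by (simp add: tr_pt_diff K_def)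
  qed
  ultimately show ?thesis unfolding normal_inv_iff by blast
qed

text \<open>Modulo the ideal every group element agrees with a member of \<open>S\<close>, so the
  image of \<open>S\<close> spans the quotient.\<close>

lemma finite_codim_if_covered:
  assumes S: "finite S" "S \<subseteq> carrier G" and cover: "\<And>x. x \<in> carrier G \<Longrightarrow> \<exists>g\<in>S. x \<otimes> inv g \<in> K"
  shows "finite_codim G I"
  unfolding finite_codim_def
proof (intro exI[of _ "pt ` S"] conjI ballI)
  show "finite (pt ` S :: ('g \<Rightarrow> 'k) set)" using S by simp
  show "pt ` S \<subseteq> group_algebra G" using S by auto
  fix f :: "'g \<Rightarrow> 'k" assume "f \<in> group_algebra G"
  then have fin: "finite {x. f x \<noteq> 0}" and sup: "{x. f x \<noteq> 0} \<subseteq> carrier G"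
    by (auto simp: group_algebra_def)
  obtain \<gamma> where \<gamma>: "\<And>x. x \<in> carrier G \<Longrightarrow> \<gamma> x \<in> S \<and> x \<otimes> inv (\<gamma> x) \<in> K" using cover by metis
  let ?F = "{x. f x \<noteq> 0}"
  \<comment> \<open>\<open>finite_codim\<close> indexes coefficients by the spanning functions, so
    the values of \<open>f\<close> are collected along the fibres of \<open>x\<close> mapped to
    \<open>pt (\<gamma> x)\<close>.\<close>
  define c where "c s = (\<Sum>x\<in>{x\<in>?F. pt (\<gamma> x) = s}. f x)" for s :: "'g \<Rightarrow> 'k"
  define h where "h = (\<lambda>y. \<Sum>x\<in>?F. - f x * (pt (\<gamma> x) y - pt x y))"
  have "h \<in> I" unfolding h_def
    by (intro ideal_sum ideal_scale, subst pt_diff_iff) (use \<gamma> sup S in auto)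
  moreover have "f = (\<lambda>y. (\<Sum>s\<in>pt ` S. c s * s y) + h y)"
  proof
    fix y
    have "(\<Sum>s\<in>pt ` S. c s * s y) = (\<Sum>s\<in>pt ` S. \<Sum>x\<in>{x\<in>?F. pt (\<gamma> x) = (s :: 'g \<Rightarrow> 'k)}. f x * pt (\<gamma> x) y)"
      unfolding c_def sum_distrib_right by (intro sum.cong refl) auto
    also have "\<dots> = (\<Sum>x\<in>?F. f x * pt (\<gamma> x) y)"
      by (rule sum.group) (use fin S \<gamma> sup in auto)
    finally have "(\<Sum>s\<in>pt ` S. c s * s y) + h y = (\<Sum>x\<in>?F. f x * pt x y)"
      by (simp add: h_def algebra_simps sum_subtractf sum.distrib)
    also have "\<dots> = f y"
      using fin by (simp add: pt_def if_distrib[of "\<lambda>u. _ * u"] sum.delta cong: if_cong)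
    finally show "f y = (\<Sum>s\<in>pt ` S. c s * s y) + h y" ..
  qed
  ultimately show "\<exists>c. \<exists>h\<in>I. f = (\<lambda>y. (\<Sum>s\<in>pt ` S. c s * s y) + h y)" by blast
qed

text \<open>Conjugating and averaging \<open>f\<close> over \<open>T\<close> and then over \<open>D\<close> leaves a multiple of \<open>1\<close>, up to a
  function that is invariant under translation by \<open>C\<close> and is killed by \<open>1 - z\<close>.\<close>
lemma central_difference_in_ideal:
  assumes f: "f \<in> I" "f \<one> \<noteq> 0"
    and D: "subgroup D G" "finite D" and T: "subgroup T G" "T \<subseteq> D"
    and C: "C \<subseteq> carrier G" "\<And>w d. w \<in> C \<Longrightarrow> d \<in> D \<Longrightarrow> w \<otimes> d = d \<otimes> w"
    and Cpow: "\<And>w z. w \<in> C - {\<one>} \<Longrightarrow> z \<in> C \<Longrightarrow> \<exists>n::nat. z = w [^] n"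
    and conj_T: "\<And>h. f h \<noteq> 0 \<Longrightarrow> h \<noteq> \<one> \<Longrightarrow> \<exists>t0\<in>T. \<exists>t\<in>T. t0 \<otimes> (h \<otimes> t \<otimes> inv h) \<in> C - {\<one>}"
    and comm_T: "\<And>t. t \<in> T \<Longrightarrow> t \<noteq> \<one> \<Longrightarrow> \<exists>d\<in>D. d \<otimes> t \<otimes> inv d \<otimes> inv t \<in> C - {\<one>}"
    and card: "of_nat (card D) \<noteq> (0::'k)" "of_nat (card T) \<noteq> (0::'k)"
    and z: "z \<in> C"
  shows "z \<in> K"
proof -
  have Dc: "d \<in> carrier G" "inv d \<in> D" if "d \<in> D" for d
    using that subgroup.mem_carrier[OF D(1)] subgroup.m_inv_closed[OF D(1)] by auto
  have Tc: "t \<in> carrier G" "t \<in> D" "inv t \<in> T" if "t \<in> T" for t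
    using that T Dc subgroup.m_inv_closed[OF T(1)] by auto
  have Cc: "w \<in> carrier G" if "w \<in> C" for w using that C by auto
  have fin: "finite {h. f h \<noteq> 0}" and sup: "{h. f h \<noteq> 0} \<subseteq> carrier G"
    using ideal_sub[OF f(1)] by (auto simp: group_algebra_def)
  have finT: "finite T" using D T finite_subset by blast
  define invariant where "invariant \<psi> \<longleftrightarrow> (\<forall>x\<in>carrier G. \<psi> (z \<otimes> x) = \<psi> x)" for \<psi> :: "'g \<Rightarrow> 'k"
  \<comment> \<open>\<open>z\<close> is a power of every nontrivial \<open>w\<close> in
    \<open>C\<close>, so invariance may be tested on whichever \<open>w\<close> is at hand.\<close>
  have invariantI: "invariant \<psi>" if w: "w \<in> C - {\<one>}" and \<psi>: "\<And>x. x \<in> carrier G \<Longrightarrow> \<psi> (w \<otimes> x) = \<psi> x" for w \<psi>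
  proof -
    obtain n :: nat where n: "z = w [^] n" using Cpow[OF w z] by blast
    have wG: "w \<in> carrier G" using w Cc by blast
    have "\<psi> (w [^] n \<otimes> x) = \<psi> x" if "x \<in> carrier G" for x and n :: nat
      using that by (induction n arbitrary: x) (auto simp: wG m_assoc \<psi>)
    then show ?thesis by (simp add: invariant_def n)
  qed
  \<comment> \<open>Unnormalised averages: \<open>P h\<close> over \<open>T\<close> on both sides
    and then over conjugation by \<open>D\<close>, \<open>Q t\<close> over conjugation only.\<close>
  define P where "P h x = (\<Sum>d\<in>D. \<Sum>t\<in>T. \<Sum>t'\<in>T. pt (d \<otimes> (t \<otimes> h \<otimes> t') \<otimes> inv d) x :: 'k)" for h x
  define Q where "Q t x = (\<Sum>d\<in>D. pt (d \<otimes> t \<otimes> inv d) x :: 'k)" for t x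
  have shift: "pt (w \<otimes> y) (w \<otimes> x) = (pt y x :: 'k)" if "w \<in> carrier G" "y \<in> carrier G" "x \<in> carrier G" for w x y
    using that by (simp add: pt_def)
  have C_conj: "d \<otimes> (w \<otimes> y) \<otimes> inv d = w \<otimes> (d \<otimes> y \<otimes> inv d)" if "w \<in> C" "d \<in> D" "y \<in> carrier G" for w d y
    using that C(2)[of w d] Cc Dc by (metis inv_closed m_assoc m_closed)
  have P_inv: "invariant (P h)" if h: "f h \<noteq> 0" "h \<noteq> \<one>" for h
  proof -
    have hG: "h \<in> carrier G" using h sup by blast
    obtain t0 t1 where t: "t0 \<in> T" "t1 \<in> T" and w: "t0 \<otimes> (h \<otimes> t1 \<otimes> inv h) \<in> C - {\<one>}"
      using conj_T[OF h] by blast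
    define w where "w = t0 \<otimes> (h \<otimes> t1 \<otimes> inv h)"
    have wC: "w \<in> C" and wG: "w \<in> carrier G" using w Cc by (auto simp: w_def)
    have wh: "t0 \<otimes> h \<otimes> t1 = w \<otimes> h" using t hG Tc by (simp add: w_def m_assoc)
    have "P h (w \<otimes> x) = P h x" if x: "x \<in> carrier G" for x
    proof -
      \<comment> \<open>Replacing \<open>t\<close> by \<open>t t0\<close> and \<open>t'\<close> by
        \<open>t1 t'\<close> puts \<open>t0 h t1 = w h\<close> in the middle, and \<open>w\<close>,
        which commutes with \<open>D\<close>, moves to the front.\<close>
      have "P h (w \<otimes> x) = (\<Sum>d\<in>D. \<Sum>t\<in>T. \<Sum>t'\<in>T. pt (d \<otimes> (t \<otimes> t0 \<otimes> h \<otimes> (t1 \<otimes> t')) \<otimes> inv d) (w \<otimes> x))"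
        unfolding P_def by (subst subgroup_sum_translate(1)[OF T(1) t(1), symmetric],
            subst subgroup_sum_translate(2)[OF T(1) t(2), symmetric]) (rule refl)
      also have "\<dots> = P h x"
        unfolding P_def
      proof (intro sum.cong refl)
        fix d t t' assume d: "d \<in> D" "t \<in> T" "t' \<in> T"
        have "t \<otimes> t0 \<otimes> h \<otimes> (t1 \<otimes> t') = t \<otimes> (t0 \<otimes> h \<otimes> t1) \<otimes> t'"
          using d t hG Tc by (simp add: m_assoc)
        also have "\<dots> = w \<otimes> (t \<otimes> h \<otimes> t')"
          using C(2)[OF wC, of t] d wG hG Tc by (simp add: wh m_assoc) (simp flip: m_assoc)
        finally show "pt (d \<otimes> (t \<otimes> t0 \<otimes> h \<otimes> (t1 \<otimes> t')) \<otimes> inv d) (w \<otimes> x) = (pt (d \<otimes> (t \<otimes> h \<otimes> t') \<otimes> inv d) x :: 'k)"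
          using d hG Tc Dc wG x by (simp add: C_conj[OF wC] shift)
      qed
      finally show ?thesis .
    qed
    then show ?thesis using invariantI w by (simp add: w_def)
  qed
  have Q_inv: "invariant (Q t)" if t: "t \<in> T" "t \<noteq> \<one>" for t
  proof -
    obtain d1 where d1: "d1 \<in> D" and w: "d1 \<otimes> t \<otimes> inv d1 \<otimes> inv t \<in> C - {\<one>}" using comm_T[OF t] by blast
    define w where "w = d1 \<otimes> t \<otimes> inv d1 \<otimes> inv t"
    have wC: "w \<in> C" and wG: "w \<in> carrier G" using w Cc by (auto simp: w_def)
    have wt: "d1 \<otimes> t \<otimes> inv d1 = w \<otimes> t" using t d1 Tc Dc by (simp add: w_def m_assoc)
    have "Q t (w \<otimes> x) = Q t x" if x: "x \<in> carrier G" for x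
    proof -
      \<comment> \<open>Replacing \<open>d\<close> by \<open>d d1\<close> turns \<open>t\<close>
        into its conjugate \<open>w t\<close>.\<close>
      have "Q t (w \<otimes> x) = (\<Sum>d\<in>D. pt (d \<otimes> d1 \<otimes> t \<otimes> inv (d \<otimes> d1)) (w \<otimes> x))"
        unfolding Q_def by (rule subgroup_sum_translate(1)[OF D(1) d1, symmetric])
      also have "\<dots> = Q t x"
        unfolding Q_def
      proof (intro sum.cong refl)
        fix d assume d: "d \<in> D"
        have "d \<otimes> d1 \<otimes> t \<otimes> inv (d \<otimes> d1) = d \<otimes> (d1 \<otimes> t \<otimes> inv d1) \<otimes> inv d"
          using d d1 t Dc Tc by (simp add: inv_mult_group m_assoc)
        then show "pt (d \<otimes> d1 \<otimes> t \<otimes> inv (d \<otimes> d1)) (w \<otimes> x) = (pt (d \<otimes> t \<otimes> inv d) x :: 'k)"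
          using d t Tc Dc wG x by (simp add: wt C_conj[OF wC] shift)
      qed
      finally show ?thesis .
    qed
    then show ?thesis using invariantI w by (simp add: w_def)
  qed
  \<comment> \<open>For \<open>h = 1\<close> each element of \<open>T\<close> arises
    \<open>card T\<close> times as a product \<open>t t'\<close>, so the two-sided average
    collapses.\<close>
  have P1: "P \<one> x = of_nat (card T) * (\<Sum>t\<in>T. Q t x)" for x
  proof -
    have "P \<one> x = (\<Sum>d\<in>D. \<Sum>t\<in>T. \<Sum>t'\<in>T. pt (d \<otimes> (t \<otimes> t') \<otimes> inv d) x)"
      unfolding P_def using Tc by (intro sum.cong refl) simp
    also have "\<dots> = (\<Sum>d\<in>D. \<Sum>t\<in>T. \<Sum>t'\<in>T. pt (d \<otimes> t' \<otimes> inv d) x)"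
      by (intro sum.cong refl subgroup_sum_translate(2)[OF T(1)])
    also have "\<dots> = of_nat (card T) * (\<Sum>d\<in>D. \<Sum>t\<in>T. pt (d \<otimes> t \<otimes> inv d) x)"
      by (simp add: sum_distrib_left)
    also have "(\<Sum>d\<in>D. \<Sum>t\<in>T. pt (d \<otimes> t \<otimes> inv d) x) = (\<Sum>t\<in>T. Q t x)"
      unfolding Q_def by (rule sum.swap)
    finally show ?thesis .
  qed
  have Q1: "Q \<one> x = of_nat (card D) * pt \<one> x" for x
    unfolding Q_def using Dc by (simp cong: sum.cong)
  define A where "A = (\<lambda>x. \<Sum>d\<in>D. \<Sum>t\<in>T. \<Sum>t'\<in>T. tr (d \<otimes> t) (t' \<otimes> inv d) f x)"
  have AI: "A \<in> I"
    unfolding A_def by (intro ideal_sum ideal_tr f) (use Dc Tc in auto)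
  let ?S = "{h. f h \<noteq> 0}"
  have A_eq: "A x = (\<Sum>h\<in>?S. f h * P h x)" if x: "x \<in> carrier G" for x
  proof -
    have "tr (d \<otimes> t) (t' \<otimes> inv d) f x = (\<Sum>h\<in>?S. f h * pt (d \<otimes> (t \<otimes> h \<otimes> t') \<otimes> inv d) x)"
      if d: "d \<in> D" "t \<in> T" "t' \<in> T" for d t t'
    proof -
      have a: "d \<otimes> t \<in> carrier G" "t' \<otimes> inv d \<in> carrier G" using d Dc Tc by auto
      define y where "y = inv (d \<otimes> t) \<otimes> x \<otimes> inv (t' \<otimes> inv d)"
      have "pt (d \<otimes> (t \<otimes> h \<otimes> t') \<otimes> inv d) x = (pt y h :: 'k)" if "h \<in> ?S" for h
      proof -
        have hG: "h \<in> carrier G" using that sup by blast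
        have "d \<otimes> (t \<otimes> h \<otimes> t') \<otimes> inv d = d \<otimes> t \<otimes> h \<otimes> (t' \<otimes> inv d)"
          using d Dc Tc hG by (simp add: m_assoc)
        then show ?thesis using tr_eq_iff[OF a hG x] by (auto simp: pt_def y_def)
      qed
      then have "(\<Sum>h\<in>?S. f h * pt (d \<otimes> (t \<otimes> h \<otimes> t') \<otimes> inv d) x) = (\<Sum>h\<in>?S. f h * pt y h)"
        by (intro sum.cong) auto
      also have "\<dots> = f y"
        using fin by (simp add: pt_def if_distrib[of "\<lambda>u. _ * u"] sum.delta' cong: if_cong)
      finally show ?thesis using x by (simp add: tr_def y_def)
    qed
    then have "A x = (\<Sum>d\<in>D. \<Sum>t\<in>T. \<Sum>t'\<in>T. \<Sum>h\<in>?S. f h * pt (d \<otimes> (t \<otimes> h \<otimes> t') \<otimes> inv d) x)"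
      unfolding A_def by (intro sum.cong refl) auto
    also have "\<dots> = (\<Sum>h\<in>?S. f h * P h x)"
      unfolding P_def by (simp add: sum_distrib_left sum.swap[of _ _ ?S])
    finally show ?thesis .
  qed
  \<comment> \<open>The coefficient contributed by \<open>h = 1\<close> and \<open>t = 1\<close>;
    all other terms go into the \<open>z\<close>-invariant part \<open>E\<close>.\<close>
  define c where "c = f \<one> * (of_nat (card T) * of_nat (card D))"
  define E where "E x = (\<Sum>h\<in>?S - {\<one>}. f h * P h x) + f \<one> * (of_nat (card T) * (\<Sum>t\<in>T - {\<one>}. Q t x))" for x
  have E_inv: "E (z \<otimes> x) = E x" if "x \<in> carrier G" for x
  proof -
    have "(\<Sum>h\<in>?S - {\<one>}. f h * P h (z \<otimes> x)) = (\<Sum>h\<in>?S - {\<one>}. f h * P h x)"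
      by (rule sum.cong) (use P_inv that in \<open>auto simp: invariant_def\<close>)
    moreover have "(\<Sum>t\<in>T - {\<one>}. Q t (z \<otimes> x)) = (\<Sum>t\<in>T - {\<one>}. Q t x)"
      by (rule sum.cong) (use Q_inv that in \<open>auto simp: invariant_def\<close>)
    ultimately show ?thesis by (simp add: E_def)
  qed
  have A_E: "A x = E x + c * pt \<one> x" if x: "x \<in> carrier G" for x
  proof -
    have "A x = f \<one> * P \<one> x + (\<Sum>h\<in>?S - {\<one>}. f h * P h x)"
      unfolding A_eq[OF x] using fin f by (intro sum.remove) auto
    moreover have "(\<Sum>t\<in>T. Q t x) = Q \<one> x + (\<Sum>t\<in>T - {\<one>}. Q t x)"
      using finT subgroup.one_closed[OF T(1)] by (intro sum.remove) auto
    ultimately show ?thesis by (simp add: E_def P1 Q1 c_def algebra_simps)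
  qed
  have zG: "z \<in> carrier G" using z Cc by blast
  \<comment> \<open>This is \<open>(1 - z) A\<close> divided by \<open>c\<close>: multiplication by
    \<open>z\<close> fixes \<open>E\<close>, so only \<open>1 - z\<close> remains.\<close>
  have "(\<lambda>x. inverse c * (A x - tr z \<one> A x)) \<in> I"
    using AI zG by (intro ideal_scale ideal_diff ideal_tr) auto
  also have "(\<lambda>x. inverse c * (A x - tr z \<one> A x)) = (\<lambda>x. pt \<one> x - pt z x)"
  proof
    fix x
    have c0: "c \<noteq> 0" using f card by (simp add: c_def)
    show "inverse c * (A x - tr z \<one> A x) = pt \<one> x - pt z x"
    proof (cases "x \<in> carrier G")
      case True
      have zx: "z \<otimes> (inv z \<otimes> x) = x" using zG True by (simp flip: m_assoc)
      have "tr z \<one> A x = E (z \<otimes> (inv z \<otimes> x)) + c * pt \<one> (inv z \<otimes> x)"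
        using True zG by (simp add: tr_def A_E E_inv)
      also have "(pt \<one> (inv z \<otimes> x) :: 'k) = pt z x"
        using True zG inv_solve_left'[of \<one> z x] by (auto simp: pt_def)
      finally show ?thesis using c0 zx True by (simp add: A_E flip: right_diff_distrib)
    next
      case False
      then show ?thesis using ideal_outside[OF AI] zG by (auto simp: tr_def pt_def)
    qed
  qed
  finally show ?thesis using zG by (simp add: K_def)
qed

end

section \<open>Assembling the levels\<close>

lemma constr_step_wreath_step:
  assumes M: "extra_special M q" and G: "group G"
    and H: "subgroup H G" "finite H" and R: "subgroup R G" "R \<subseteq> H"
    and normal: "\<And>h x. h \<in> H \<Longrightarrow> x \<in> R \<Longrightarrow> inv\<^bsub>G\<^esub> h \<otimes>\<^bsub>G\<^esub> x \<otimes>\<^bsub>G\<^esub> h \<in> R"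
    and card: "prime (card R)" "card R \<noteq> q"
    and step: "constr_step G H R M Gi D Ri"
  obtains m a b \<phi> where "wreath_step M q m a b G H R D Gi \<phi>"
proof -
  obtain m a b where "ncomm_pair M q m a b" using extra_special_ncomm_pair[OF M] .
  then have "wreath_base M q m a b G H R"
    using G H R normal card by (simp add: wreath_base_def wreath_base_axioms_def)
  moreover obtain \<phi> where "wreath_step_axioms M G H R D Gi \<phi>"
    using step unfolding constr_step_def wreath_step_axioms_def by blast
  ultimately show ?thesis by (intro that wreath_step.intro)
qed

context wreath_step
begin

text \<open>These are the properties that \<open>wreath_base\<close> demands of \<open>R\<close> at
  the next level.\<close>

lemma derived_D_normal_prime:
  "subgroup (derived G D) G" "derived G D \<subseteq> Gi" "card (derived G D) = q"
  "g \<in> Gi \<Longrightarrow> x \<in> derived G D \<Longrightarrow> inv\<^bsub>G\<^esub> g \<otimes>\<^bsub>G\<^esub> x \<otimes>\<^bsub>G\<^esub> g \<in> derived G D"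
  unfolding derived_D using C_subgroup card_C C_normal by (auto simp: C_def dest: lift_D intro: D_Gi)

lemma card_T_dvd: "card T dvd card D"
proof -
  interpret DG: group "G\<lparr>carrier := D\<rparr>" by (rule G.subgroup_imp_group[OF D_sub])
  have "subgroup T (G\<lparr>carrier := D\<rparr>)" using G.subgroup_incl[OF T_subgroup D_sub T_D] .
  from DG.lagrange[OF this] have "card T dvd order (G\<lparr>carrier := D\<rparr>)"
    by (rule dvdI[OF trans[OF sym mult.commute]])
  then show ?thesis by (simp add: order_def)
qed

text \<open>The orders of \<open>D\<close> and \<open>T\<close> are powers of \<open>q\<close>,
  hence invertible in the field, and the support of \<open>f\<close> lies in \<open>H\<close>, where
  \<open>T_conj\<close> applies.\<close>

lemma derived_D_subset_ideal_kernel: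
  fixes I :: "('g \<Rightarrow> 'k::field) set"
  assumes I: "two_sided_ideal G I" and q: "q \<noteq> CHAR('k)"
    and f: "f \<in> I" "f \<one>\<^bsub>G\<^esub> \<noteq> 0" "\<And>x. f x \<noteq> 0 \<Longrightarrow> x \<in> H"
  shows "derived G D \<subseteq> group_algebra_ideal.K G I"
proof
  interpret J: group_algebra_ideal G I
    by (intro group_algebra_ideal.intro group_algebra_ideal_axioms.intro I G.is_group)
  obtain j where j: "card D = q ^ j" using card_D by blast
  have "\<not> CHAR('k) dvd q"
    using prime_q q CHAR_not_1[where 'a = 'k] by (auto simp: prime_nat_iff)
  then have "of_nat q \<noteq> (0::'k)" by (simp add: of_nat_eq_0_iff_char_dvd)
  then have D0: "of_nat (card D) \<noteq> (0::'k)" by (simp add: j)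
  then have T0: "of_nat (card T) \<noteq> (0::'k)" using card_T_dvd by (auto elim!: dvdE)
  fix z assume "z \<in> derived G D"
  then have z: "z \<in> C" by (simp add: derived_D)
  show "z \<in> J.K"
  proof (rule J.central_difference_in_ideal[OF f(1,2) D_sub finite_D T_subgroup T_D _ _ _ _ _ D0 T0 z])
    show "C \<subseteq> carrier G" using C_subgroup by (rule subgroup.subset)
    show "w \<otimes>\<^bsub>G\<^esub> d = d \<otimes>\<^bsub>G\<^esub> w" if "w \<in> C" "d \<in> D" for w d
      using that lift_zf_comm by (auto simp: C_def)
    show "\<exists>n::nat. z = w [^]\<^bsub>G\<^esub> n" if "w \<in> C - {\<one>\<^bsub>G\<^esub>}" "z \<in> C" for w z
      using that lift_zf_power by (auto simp: C_def)
    show "\<exists>t0\<in>T. \<exists>t\<in>T. t0 \<otimes>\<^bsub>G\<^esub> (h \<otimes>\<^bsub>G\<^esub> t \<otimes>\<^bsub>G\<^esub> inv\<^bsub>G\<^esub> h) \<in> C - {\<one>\<^bsub>G\<^esub>}" if "f h \<noteq> 0" "h \<noteq> \<one>\<^bsub>G\<^esub>" for h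
      using that T_conj f(3) by blast
    show "\<exists>d\<in>D. d \<otimes>\<^bsub>G\<^esub> t \<otimes>\<^bsub>G\<^esub> inv\<^bsub>G\<^esub> d \<otimes>\<^bsub>G\<^esub> inv\<^bsub>G\<^esub> t \<in> C - {\<one>\<^bsub>G\<^esub>}" if "t \<in> T" "t \<noteq> \<one>\<^bsub>G\<^esub>" for t
      using that by (rule T_noncommuting)
  qed
qed

end

theorem theorem2p9:
  fixes ps :: "nat \<Rightarrow> nat"
    and Ms :: "nat \<Rightarrow> 'm monoid"
    and G :: "'g monoid"
    and Gs Ds Rs :: "nat \<Rightarrow> 'g set"
    and I :: "('g \<Rightarrow> 'k::field) set"
  assumes primes: "\<forall>i\<ge>1. prime (ps i)"
    and consec: "\<forall>i\<ge>1. ps (Suc i) \<noteq> ps i"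
    and repeat: "\<forall>i\<ge>1. \<exists>u v. i < u \<and> u < v \<and> ps u = ps v \<and> ps u \<noteq> CHAR('k)"
    and Ms_es: "\<forall>i\<ge>2. extra_special (Ms i) (ps i) \<and> card (carrier (Ms i)) = ps i ^ 3"
    and grp: "group G"
    and G1_sub: "subgroup (Gs 1) G"
    and G1_cyc: "\<exists>g \<in> carrier G. Gs 1 = generate G {g}"
    and G1_card: "card (Gs 1) = ps 1"
    and R1: "Rs 1 = Gs 1"
    and steps: "\<forall>i\<ge>2. constr_step G (Gs (i - 1)) (Rs (i - 1)) (Ms i) (Gs i) (Ds i) (Rs i)"
    and union: "carrier G = (\<Union>i\<in>{1..}. Gs i)"
    and ideal: "two_sided_ideal G I"
    and nonzero: "\<exists>f \<in> I. f \<noteq> (\<lambda>_. 0)"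
  shows "finite_codim G I"
proof -
  interpret group G by fact
  interpret group_algebra_ideal G I
    by unfold_locales (rule ideal)
  interpret K: normal K G by (rule K_normal)
  define level where "level i m a b \<phi> \<longleftrightarrow>
    wreath_step (Ms (Suc i)) (ps (Suc i)) m a b G (Gs i) (Rs i) (Ds (Suc i)) (Gs (Suc i)) \<phi>" for i m a b \<phi>
  \<comment> \<open>The inductive invariant under which a construction step is an instance of
    \<open>wreath_step\<close>.\<close>
  define good where "good i \<longleftrightarrow> subgroup (Gs i) G \<and> finite (Gs i) \<and> subgroup (Rs i) G \<and> Rs i \<subseteq> Gs i
    \<and> (\<forall>h\<in>Gs i. \<forall>x\<in>Rs i. inv\<^bsub>G\<^esub> h \<otimes>\<^bsub>G\<^esub> x \<otimes>\<^bsub>G\<^esub> h \<in> Rs i) \<and> card (Rs i) = ps i" for i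
  have good_level: "\<exists>m a b \<phi>. level i m a b \<phi>" if i: "i \<ge> 1" and g: "good i" for i
  proof -
    have "extra_special (Ms (Suc i)) (ps (Suc i))" using Ms_es i by simp
    moreover have "constr_step G (Gs i) (Rs i) (Ms (Suc i)) (Gs (Suc i)) (Ds (Suc i)) (Rs (Suc i))"
      using steps[rule_format, of "Suc i"] i by simp
    moreover have "prime (ps i)" "ps i \<noteq> ps (Suc i)" using primes consec i by metis+
    ultimately obtain m a b \<phi> where "level i m a b \<phi>"
      using constr_step_wreath_step[of "Ms (Suc i)" "ps (Suc i)" G "Gs i" "Rs i" "Gs (Suc i)" "Ds (Suc i)" "Rs (Suc i)"]
        g grp unfolding good_def level_def by metis
    then show ?thesis by blast
  qed
  have R_derived: "Rs (Suc i) = derived G (Ds (Suc i))" if "i \<ge> 1" for i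
    using steps[rule_format, of "Suc i"] that by (simp add: constr_step_def)
  have good: "good i" if "i \<ge> 1" for i
    using that
  proof (induction i rule: dec_induct)
    case base
    have "finite (Gs 1)" using G1_card primes by (metis card.infinite le_refl not_prime_0)
    moreover have "inv\<^bsub>G\<^esub> h \<otimes>\<^bsub>G\<^esub> x \<otimes>\<^bsub>G\<^esub> h \<in> Gs 1" if "h \<in> Gs 1" "x \<in> Gs 1" for h x
      using that G1_sub by (simp add: subgroup.m_closed subgroup.m_inv_closed)
    ultimately show ?case using G1_sub G1_card R1 by (auto simp: good_def)
  next
    case (step i)
    then obtain m a b \<phi> where "level i m a b \<phi>" using good_level by blast
    then interpret W: wreath_step "Ms (Suc i)" "ps (Suc i)" m a b G "Gs i" "Rs i" "Ds (Suc i)" "Gs (Suc i)" \<phi>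
      by (simp add: level_def)
    show ?case
      unfolding good_def R_derived[OF step(1)]
      using W.Gi_sub W.finite_Gi W.derived_D_normal_prime by blast
  qed
  have mono: "Gs i \<subseteq> Gs j" if "1 \<le> i" "i \<le> j" for i j
    using that(2)
  proof (induction j rule: dec_induct)
    case (step j)
    then obtain m a b \<phi> where "level j m a b \<phi>" using good_level good \<open>1 \<le> i\<close> by (meson le_trans)
    then interpret W: wreath_step "Ms (Suc j)" "ps (Suc j)" m a b G "Gs j" "Rs j" "Ds (Suc j)" "Gs (Suc j)" \<phi>
      by (simp add: level_def)
    show ?case using step W.H_Gi by blast
  qed simp

  obtain f0 x0 where f0: "f0 \<in> I" "f0 x0 \<noteq> 0" using nonzero by fastforce
  have x0: "x0 \<in> carrier G" using f0 ideal_outside by blast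
  \<comment> \<open>Translation moves a nonzero coefficient to the identity:
    \<open>f(1) = f0(x0)\<close>.\<close>
  define f where "f = tr (inv\<^bsub>G\<^esub> x0) \<one>\<^bsub>G\<^esub> f0"
  have f: "f \<in> I" "f \<one>\<^bsub>G\<^esub> \<noteq> 0"
    using f0 x0 ideal_tr[of f0 "inv\<^bsub>G\<^esub> x0" "\<one>\<^bsub>G\<^esub>"] by (simp_all add: f_def tr_def)
  have fin: "finite {x. f x \<noteq> 0}" and sup: "{x. f x \<noteq> 0} \<subseteq> carrier G"
    using ideal_sub[OF f(1)] by (auto simp: group_algebra_def)
  have "\<exists>i\<ge>1. S \<subseteq> Gs i" if "finite S" "S \<subseteq> carrier G" for S
    using that
  proof (induction S)
    case empty
    then show ?case by auto
  next
    case (insert x S)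
    then obtain i j where i: "i \<ge> 1" "S \<subseteq> Gs i" "j \<ge> 1" "x \<in> Gs j" using union by auto
    then have "insert x S \<subseteq> Gs (max i j)" using mono[of i "max i j"] mono[of j "max i j"] by auto
    then show ?case using i by (meson max.coboundedI1)
  qed
  then obtain i where i: "i \<ge> 1" "{x. f x \<noteq> 0} \<subseteq> Gs i" using fin sup by blast
  \<comment> \<open>Beyond \<open>i\<close>, so that the preceding level \<open>u\<close> still
    contains the support of \<open>f\<close>.\<close>
  obtain u' where u': "i < u'" "ps u' \<noteq> CHAR('k)" using repeat i(1) by blast
  then obtain u where u: "u' = Suc u" "i \<le> u" by (cases u') auto
  have u1: "u \<ge> 1" using u i by simp
  have R_K: "Rs (Suc u) \<subseteq> K"
  proof -
    obtain m a b \<phi> where "level u m a b \<phi>" using good_level good u1 by blast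
    then interpret W: wreath_step "Ms (Suc u)" "ps (Suc u)" m a b G "Gs u" "Rs u" "Ds (Suc u)" "Gs (Suc u)" \<phi>
      by (simp add: level_def)
    show ?thesis
      unfolding R_derived[OF u1]
      using W.derived_D_subset_ideal_kernel[OF ideal _ f] u'(2) u i mono[of i u] by auto
  qed
  \<comment> \<open>Both claims propagate together: \<open>Rs j\<close> inside \<open>K\<close>
    forces \<open>Ds (Suc j)\<close> into \<open>K\<close>, so \<open>Gs (Suc j)\<close> meets no
    new coset of \<open>K\<close>, and \<open>Rs (Suc j)\<close>, being contained in
    \<open>Ds (Suc j)\<close>, again lies in \<open>K\<close>.\<close>
  have RD_K: "Rs j \<subseteq> K \<and> (\<forall>x\<in>Gs j. \<exists>g\<in>Gs (Suc u). x \<otimes>\<^bsub>G\<^esub> inv\<^bsub>G\<^esub> g \<in> K)" if "j \<ge> Suc u" for j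
    using that
  proof (induction j rule: dec_induct)
    case base
    have "x \<otimes>\<^bsub>G\<^esub> inv\<^bsub>G\<^esub> x \<in> K" if "x \<in> Gs (Suc u)" for x
    proof -
      have "x \<in> carrier G" using that union by auto
      then show ?thesis using K.one_closed by simp
    qed
    then show ?case using R_K by blast
  next
    case (step j)
    then have j: "j \<ge> 1" by simp
    obtain m a b \<phi> where "level j m a b \<phi>" using good_level good j by blast
    then interpret W: wreath_step "Ms (Suc j)" "ps (Suc j)" m a b G "Gs j" "Rs j" "Ds (Suc j)" "Gs (Suc j)" \<phi>
      by (simp add: level_def)
    have D: "Ds (Suc j) \<subseteq> K" using W.D_subset_normal[OF K_normal] step by blast
    then have "Rs (Suc j) \<subseteq> K"
      using R_derived[OF j] W.derived_D W.C_def W.lift_D by auto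
    moreover have "\<exists>g\<in>Gs (Suc u). x \<otimes>\<^bsub>G\<^esub> inv\<^bsub>G\<^esub> g \<in> K" if "x \<in> Gs (Suc j)" for x
    proof -
      obtain d h where x: "d \<in> Ds (Suc j)" "h \<in> Gs j" "x = d \<otimes>\<^bsub>G\<^esub> h"
        using \<open>x \<in> Gs (Suc j)\<close> unfolding W.DH[symmetric] set_mult_def by blast
      then obtain g where g: "g \<in> Gs (Suc u)" "h \<otimes>\<^bsub>G\<^esub> inv\<^bsub>G\<^esub> g \<in> K" using step by blast
      have "g \<in> carrier G" using g union by auto
      then have "x \<otimes>\<^bsub>G\<^esub> inv\<^bsub>G\<^esub> g = d \<otimes>\<^bsub>G\<^esub> (h \<otimes>\<^bsub>G\<^esub> inv\<^bsub>G\<^esub> g)" using x by (simp add: m_assoc)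
      moreover have "d \<otimes>\<^bsub>G\<^esub> (h \<otimes>\<^bsub>G\<^esub> inv\<^bsub>G\<^esub> g) \<in> K" using g(2) D x(1) K.m_closed by blast
      ultimately have "x \<otimes>\<^bsub>G\<^esub> inv\<^bsub>G\<^esub> g \<in> K" by (simp only:)
      then show ?thesis using g(1) by blast
    qed
    ultimately show ?case by blast
  qed
  show ?thesis
  proof (rule finite_codim_if_covered[of "Gs (Suc u)"])
    show "finite (Gs (Suc u))" using good[of "Suc u"] by (simp add: good_def)
    show "Gs (Suc u) \<subseteq> carrier G" using union by auto
    fix x assume "x \<in> carrier G"
    then obtain j where "j \<ge> 1" "x \<in> Gs j" using union by auto
    then have "x \<in> Gs (max j (Suc u))" using mono[of j "max j (Suc u)"] by auto
    then show "\<exists>g\<in>Gs (Suc u). x \<otimes>\<^bsub>G\<^esub> inv\<^bsub>G\<^esub> g \<in> K" using RD_K[of "max j (Suc u)"] by simp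
  qed
qed

end
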